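(* The assignment $U\mapsto \mathcal F(U)$ is the minimal class of functions on finite-dimensional $\mathbb Z$-graded charts which contains the polynomials in the variables of non-zero degree with coefficients smooth in the degree zero variables and which is stable under degree preserving morphisms of the same type. That is: (i) $\mathcal P(U)\subseteq\mathcal F(U)$ for every graded chart $U$, and $\phi^*(\mathcal F(U'))\subseteq \mathcal F(U)$ for every $\mathcal F$-morphism $\phi\colon U\to U'$ between graded charts; (ii) if $\mathcal C$ is any class of functions such that $\mathcal P(U)\subseteq \mathcal C(U)\subseteq\mathcal F(U)$ for every graded chart $U$ and $\phi^*(\mathcal C(U'))\subseteq\mathcal C(U)$ for every $\mathcal C$-morphism $\phi\colon U\to U'$, then $\mathcal C(U)=\mathcal F(U)$ for every graded chart $U$.
   Context: A (finite-dimensional, smooth, $\mathbb Z$-)graded chart is a pair $U=(\underline U,V)$, where $\underline U\subseteq\mathbb R^n$ is open (any $n\ge 0$) with coordinates $x=(x^1,\dots,x^n)$ of degree $0$, and $V=\bigoplus_{i\in\mathbb Z\setminus\{0\}}V_i$ is a finite-dimensional $\mathbb Z$-graded real vector space with no degree $0$ part. $V$ has homogeneous coordinates of non-zero integer degrees: even-degree ones $\zeta_1,\dots,\zeta_{D_1}$ and odd-degree ones $\eta_1,\dots,\eta_{D_2}$. Variables commute up to the sign $ab=(-1)^{\deg a\deg b}ba$; in particular the $\eta$'s anticommute and square to zero. $\mathcal F(U)_k$ is the space of formal power series $$f=\sum_{i_1,\dots,i_{D_1}\ge 0;\ j_1,\dots,j_{D_2}\in\{0,1\}} f_{i_1\dots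 i_{D_1}j_1\dots j_{D_2}}(x)\,\zeta_1^{i_1}\cdots\zeta_{D_1}^{i_{D_1}}\eta_1^{j_1}\cdots\eta_{D_2}^{j_{D_2}},$$ with $f_{i_1\dots j_{D_2}}\in C^\infty(\underline U)$, in which only monomials with $\sum_\alpha i_\alpha\deg\zeta_\alpha+\sum_\alpha j_\alpha\deg\eta_\alpha=k$ occur, and $\mathcal F(U)=\bigoplus_{k\in\mathbb Z}\mathcal F(U)_k$ (finite sums of homogeneous elements). $\mathcal P(U)\subseteq \mathcal F(U)$ is the subspace of polynomials in the $\zeta$'s and $\eta$'s with coefficients in $C^\infty(\underline U)$. A class of functions $\mathcal C$ assigns to every graded chart $U$ a subset $\mathcal C(U)\subseteq \mathcal F(U)$. Let $U,U'$ be graded charts, $U'$ having degree zero coordinates $y^i$ and homogeneous coordinates $\tau^j$ of non-zero degree. A degree preserving morphism $\phi\colon U\to U'$ is given by component functions $\phi^*(y^i)\in\mathcal F(U)_0$ and $\phi^*(\tau^j)\in\mathcal F(U)_{\deg\tau^j}$ such that, writing $\phi^*(y^i)=f_0^i(x)+n^i$ with $n^i$ having no term independent of $V$-variables, the map $f_0=(f_0^i)$ sends $\underline U$ into $\underline U'$. The pull-back of $g=\sum_K g_K(y)\tau^K\in\mathcal F(U')$ is defined by Taylor expansion: $\phi^*g=\sum_K\sum_L\frac1{L!}(\partial_y^Lg_K)(f_0(x))\,n^L\,(\phi^*\tau)^K$ ($K,L$ multi-indices). A $\mathcal C$-morphism ("of the same type") is a degree preserving morphism all of whose component functions lie in $\mathcal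 C(U)$. *)

theory Defs
  imports "HOL-Analysis.Analysis" "HOL-Library.Multiset"
begin

section \<open>Smooth functions on open subsets of R^n\<close>

text \<open>
  The dimension n varies from chart to chart, so points of R^n are functions
  \<open>nat \<Rightarrow> real\<close> vanishing at all indices \<open>\<ge> n\<close>, as in \<^const>\<open>Euclidean_space\<close>.
\<close>

definition pd :: "nat \<Rightarrow> ((nat \<Rightarrow> real) \<Rightarrow> real) \<Rightarrow> (nat \<Rightarrow> real) \<Rightarrow> real" where
  "pd i f = (\<lambda>x. deriv (\<lambda>t. f (x(i := t))) (x i))"

abbreviation pds :: "nat list \<Rightarrow> ((nat \<Rightarrow> real) \<Rightarrow> real) \<Rightarrow> (nat \<Rightarrow> real) \<Rightarrow> real" where
  "pds is f \<equiv> foldr pd is f"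

text \<open>
  Iterated partial derivatives of all orders exist and are continuous on \<open>S\<close>. A smooth function
  on \<open>S\<close> is represented by its extension by zero, so that equality of functions on \<open>S\<close> is
  equality in HOL; since \<open>S\<close> will be open in R^n, the values off \<open>S\<close> have no influence on
  derivatives at points of \<open>S\<close>.
\<close>

definition smooth_funs :: "nat \<Rightarrow> (nat \<Rightarrow> real) set \<Rightarrow> ((nat \<Rightarrow> real) \<Rightarrow> real) set" where
  "smooth_funs n S = {f.
     (\<forall>is. set is \<subseteq> {..<n} \<longrightarrow>
        continuous_on S (pds is f) \<and>
        (\<forall>i<n. \<forall>x\<in>S. (\<lambda>t. pds is f (x(i := t))) differentiable (at (x i)))) \<and>
     (\<forall>x. x \<notin> S \<longrightarrow> f x = 0)}"


section \<open>Graded charts\<close>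

text \<open>
  The graded vector space V is given by the degrees of its homogeneous coordinates:
  \<open>even_degs\<close> lists the degrees of \<open>\<zeta>\<^sub>1, \<zeta>\<^sub>2, \<dots>\<close> and \<open>odd_degs\<close> those of \<open>\<eta>\<^sub>1, \<eta>\<^sub>2, \<dots>\<close>.
  All coordinates are indexed from 0.
\<close>

record chart =
  base_dim :: nat
  base :: "(nat \<Rightarrow> real) set"
  even_degs :: "int list"
  odd_degs :: "int list"

definition graded_chart :: "chart \<Rightarrow> bool" where
  "graded_chart U \<longleftrightarrow>
     openin (Euclidean_space (base_dim U)) (base U) \<and>
     (\<forall>d\<in>set (even_degs U). even d \<and> d \<noteq> 0) \<and>
     (\<forall>d\<in>set (odd_degs U). odd d)"


section \<open>Graded functions\<close>

text \<open>
  The monomial \<open>(I, J)\<close> is the product of the \<open>\<zeta>\<^sub>a\<close> to the power \<open>count I a\<close> and of the \<open>\<eta>\<^sub>j\<close> with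
  \<open>j \<in> J\<close>, the \<open>\<eta>\<close>'s in increasing order of their indices. A series maps each monomial to its
  coefficient function.
\<close>

type_synonym monomial = "nat multiset \<times> nat set"
type_synonym series = "monomial \<Rightarrow> (nat \<Rightarrow> real) \<Rightarrow> real"

definition monomials :: "chart \<Rightarrow> monomial set" where
  "monomials U = {(I, J). set_mset I \<subseteq> {..<length (even_degs U)} \<and> J \<subseteq> {..<length (odd_degs U)}}"

definition mdeg :: "chart \<Rightarrow> monomial \<Rightarrow> int" where
  "mdeg U = (\<lambda>(I, J). (\<Sum>a\<in>#I. even_degs U ! a) + (\<Sum>j\<in>J. odd_degs U ! j))"

definition graded_funs_hom :: "chart \<Rightarrow> int \<Rightarrow> series set" where
  "graded_funs_hom U k = {f.
     (\<forall>M. f M \<in> smooth_funs (base_dim U) (base U)) \<and>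
     (\<forall>M. f M \<noteq> (\<lambda>x. 0) \<longrightarrow> M \<in> monomials U \<and> mdeg U M = k)}"

definition graded_funs :: "chart \<Rightarrow> series set" where
  "graded_funs U = {(\<lambda>M x. \<Sum>k\<in>A. h k M x) | A h. finite A \<and> (\<forall>k\<in>A. h k \<in> graded_funs_hom U k)}"

definition polynomial_funs :: "chart \<Rightarrow> series set" where
  "polynomial_funs U = {f.
     (\<forall>M. f M \<in> smooth_funs (base_dim U) (base U)) \<and>
     (\<forall>M. f M \<noteq> (\<lambda>x. 0) \<longrightarrow> M \<in> monomials U) \<and>
     finite {M. f M \<noteq> (\<lambda>x. 0)}}"


section \<open>Products of series\<close>

text \<open>
  Reordering \<open>\<eta>\<^sup>J \<eta>\<^sup>J'\<close> (for disjoint \<open>J\<close>, \<open>J'\<close>) into increasing order produces one sign for each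
  pair of \<open>\<eta>\<close>'s that has to be interchanged. The \<open>\<zeta>\<close>'s have even degree and never contribute.
\<close>

definition koszul_sign :: "nat set \<Rightarrow> nat set \<Rightarrow> real" where
  "koszul_sign J J' = (-1) ^ card {(a, b). a \<in> J \<and> b \<in> J' \<and> b < a}"

definition ser_mult :: "series \<Rightarrow> series \<Rightarrow> series" where
  "ser_mult f g = (\<lambda>(I, J) x.
     \<Sum>I'\<in>{I'. I' \<subseteq># I}. \<Sum>J'\<in>Pow J.
       koszul_sign J' (J - J') * f (I', J') x * g (I - I', J - J') x)"

definition ser_one :: series where
  "ser_one = (\<lambda>M x. if M = ({#}, {}) then 1 else 0)"

definition ser_prod :: "series list \<Rightarrow> series" where
  "ser_prod fs = foldr ser_mult fs ser_one"


section \<open>Morphisms\<close>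

text \<open>
  The component functions of a morphism into a chart \<open>U'\<close>: pull-backs of \<open>y\<^sup>i\<close> and of the even and
  odd coordinates of non-zero degree. Components at indices beyond the number of the respective
  coordinates of \<open>U'\<close> are never used.
\<close>

record components =
  comp_base :: "nat \<Rightarrow> series"
  comp_even :: "nat \<Rightarrow> series"
  comp_odd :: "nat \<Rightarrow> series"

definition body_map :: "chart \<Rightarrow> components \<Rightarrow> (nat \<Rightarrow> real) \<Rightarrow> nat \<Rightarrow> real" where
  "body_map U' \<phi> x = (\<lambda>i. if i < base_dim U' then comp_base \<phi> i ({#}, {}) x else 0)"

definition nil_part :: "components \<Rightarrow> nat \<Rightarrow> series" where
  "nil_part \<phi> i = (\<lambda>M x. if M = ({#}, {}) then 0 else comp_base \<phi> i M x)"

definition degree_preserving :: "chart \<Rightarrow> chart \<Rightarrow> components \<Rightarrow> bool" where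
  "degree_preserving U U' \<phi> \<longleftrightarrow>
     (\<forall>i<base_dim U'. comp_base \<phi> i \<in> graded_funs_hom U 0) \<and>
     (\<forall>a<length (even_degs U'). comp_even \<phi> a \<in> graded_funs_hom U (even_degs U' ! a)) \<and>
     (\<forall>j<length (odd_degs U'). comp_odd \<phi> j \<in> graded_funs_hom U (odd_degs U' ! j)) \<and>
     body_map U' \<phi> ` base U \<subseteq> base U'"

definition class_morphism :: "(chart \<Rightarrow> series set) \<Rightarrow> chart \<Rightarrow> chart \<Rightarrow> components \<Rightarrow> bool" where
  "class_morphism C U U' \<phi> \<longleftrightarrow>
     degree_preserving U U' \<phi> \<and>
     (\<forall>i<base_dim U'. comp_base \<phi> i \<in> C U) \<and>
     (\<forall>a<length (even_degs U'). comp_even \<phi> a \<in> C U) \<and>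
     (\<forall>j<length (odd_degs U'). comp_odd \<phi> j \<in> C U)"

text \<open>
  Multi-indices \<open>L\<close> in the degree zero coordinates are multisets of indices; \<open>multi_fact L\<close> is \<open>L!\<close>.
  The sum in \<open>pullback\<close> is formal: for a degree preserving morphism, the coefficient of a given
  monomial receives only finitely many non-zero contributions \<open>(K, L)\<close>, and \<^const>\<open>infsum\<close> is then
  their finite sum. The restriction to \<open>base U\<close> is the extension-by-zero convention for
  coefficient functions.
\<close>

definition multi_fact :: "nat multiset \<Rightarrow> real" where
  "multi_fact L = (\<Prod>i\<in>set_mset L. fact (count L i))"

definition nil_power :: "components \<Rightarrow> nat multiset \<Rightarrow> series" where
  "nil_power \<phi> L = ser_prod (map (nil_part \<phi>) (sorted_list_of_multiset L))"

definition comp_power :: "components \<Rightarrow> monomial \<Rightarrow> series" where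
  "comp_power \<phi> = (\<lambda>(I, J). ser_prod
     (map (comp_even \<phi>) (sorted_list_of_multiset I) @ map (comp_odd \<phi>) (sorted_list_of_set J)))"

definition pullback :: "chart \<Rightarrow> chart \<Rightarrow> components \<Rightarrow> series \<Rightarrow> series" where
  "pullback U U' \<phi> g = (\<lambda>M x.
     if x \<in> base U then
       \<Sum>\<^sub>\<infinity>(K, L) \<in> monomials U' \<times> {L. set_mset L \<subseteq> {..<base_dim U'}}.
         1 / multi_fact L * pds (sorted_list_of_multiset L) (g K) (body_map U' \<phi> x) *
         ser_mult (nil_power \<phi> L) (comp_power \<phi> K) M x
     else 0)"


section \<open>Classes of functions\<close>

definition function_class :: "(chart \<Rightarrow> series set) \<Rightarrow> bool" where
  "function_class C \<longleftrightarrow> (\<forall>U. graded_chart U \<longrightarrow> C U \<subseteq> graded_funs U)"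

definition contains_polynomials :: "(chart \<Rightarrow> series set) \<Rightarrow> bool" where
  "contains_polynomials C \<longleftrightarrow> (\<forall>U. graded_chart U \<longrightarrow> polynomial_funs U \<subseteq> C U)"

definition morphism_stable :: "(chart \<Rightarrow> series set) \<Rightarrow> bool" where
  "morphism_stable C \<longleftrightarrow>
     (\<forall>U U' \<phi>. graded_chart U \<and> graded_chart U' \<and> class_morphism C U U' \<phi> \<longrightarrow>
        pullback U U' \<phi> ` C U' \<subseteq> C U)"

end

theory Submission
  imports Defs
begin

text \<open>
  Stability: only finitely many terms of the Taylor expansion contribute to a given coefficient of
  \<open>\<phi>\<^sup>*g\<close>, because every factor \<open>n\<^sup>i\<close> or \<open>\<phi>\<^sup>*\<tau>\<^sup>j\<close> contains at least one variable of non-zero degree.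

  Minimality: a graded function is a single pull-back of a polynomial along a morphism with polynomial
  components. The even monomials of degree \<open>d\<close> are products of finitely many of them with powers of the
  degree zero monomials \<open>m = \<zeta>\<^sub>a\<^bsup>|deg \<zeta>\<^sub>b|\<^esup> \<zeta>\<^sub>b\<^bsup>|deg \<zeta>\<^sub>a|\<^esup>\<close>, where \<open>\<zeta>\<^sub>a\<close> and \<open>\<zeta>\<^sub>b\<close> have degrees of opposite
  sign. Hence \<open>f\<close> is a polynomial in the \<open>\<zeta>\<close>'s and \<open>\<eta>\<close>'s whose coefficients are formal power series in
  the \<open>m\<close>'s over the smooth functions of \<open>x\<close>. By Borel's lemma with parameters these series are Taylor
  expansions of smooth functions of \<open>(x, y)\<close> at \<open>y = 0\<close>, and substituting the \<open>m\<close>'s for the \<open>y\<close>'s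
  recovers \<open>f\<close>.
\<close>

section \<open>Calculus on open subsets of coordinate space\<close>

text \<open>A class \<open>C\<close> is only a family of subsets; no closure under sums, products or
  limits is assumed. The infinitely many coefficients of \<open>f\<close> must enter through one
  pull-back of a function known to lie in \<open>C\<close>, and the infinite process available in
  pulling back a polynomial is the Taylor expansion in the degree 0 variables. Auxiliary degree 0
  coordinates that are sent to degree 0 monomials give access to it. If all even coordinates have
  degrees of one sign, there are no such monomials; each degree then has finitely many monomials,
  and graded functions are already polynomials. Factorisations of a monomial into a cofactor and
  generators are not unique, so one is fixed per monomial and the Taylor coefficients of all other
  pairs are prescribed as 0. Smoothness is formulated through iterated derivatives along coordinate
  lines, in varying dimension; the chain rule and the other closure properties are derived from this
  formulation. In Borel's lemma the parameter ranges over a set that is not compact in general, so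
  the estimates are imposed along a compact exhaustion.\<close>

lemma openin_Euclidean_spaceD:
  assumes "openin (Euclidean_space n) S" "x \<in> S"
  shows "i \<ge> n \<Longrightarrow> x i = 0"
  using openin_subset[OF assms(1)] assms(2) by (auto simp: topspace_Euclidean_space)

lemma openin_Euclidean_space_eq_Int:
  assumes "openin (Euclidean_space n) S"
  obtains T where "open T" "S = T \<inter> {x. \<forall>i\<ge>n. x i = 0}"
  using assms unfolding Euclidean_space_def openin_subtopology euclidean_product_topology
  by auto

lemma openin_Euclidean_space_Int:
  "open T \<Longrightarrow> openin (Euclidean_space n) (T \<inter> {x. \<forall>i\<ge>n. x i = 0})"
  unfolding Euclidean_space_def openin_subtopology euclidean_product_topology
  by auto

lemma tendsto_fun_iff:
  fixes f :: "'a \<Rightarrow> 'b \<Rightarrow> real"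
  shows "(f \<longlongrightarrow> l) F \<longleftrightarrow> (\<forall>i. ((\<lambda>t. f t i) \<longlongrightarrow> l i) F)"
  using limitin_componentwise[of "\<lambda>_. euclideanreal" UNIV f l F]
  by (simp add: euclidean_product_topology)

lemma openin_Euclidean_space_box:
  assumes "openin (Euclidean_space n) S" "x \<in> S"
  obtains e where "e > 0" "\<And>y. (\<And>i. i < n \<Longrightarrow> \<bar>y i - x i\<bar> < e) \<Longrightarrow> (\<And>i. i \<ge> n \<Longrightarrow> y i = 0) \<Longrightarrow> y \<in> S"
proof -
  obtain T where T: "open T" "S = T \<inter> {x. \<forall>i\<ge>n. x i = 0}"
    using openin_Euclidean_space_eq_Int[OF assms(1)] .
  have "x \<in> T" using T assms by auto
  have "openin (product_topology (\<lambda>i. euclideanreal) UNIV) T"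
    using T by (simp add: euclidean_product_topology)
  from product_topology_open_contains_basis[OF this \<open>x \<in> T\<close>]
  obtain X where X: "x \<in> Pi\<^sub>E UNIV X" "\<And>i. open (X i)" "Pi\<^sub>E UNIV X \<subseteq> T" by auto
  have "\<exists>e>0. ball (x i) e \<subseteq> X i" for i
    using X(1,2) by (auto intro: openE)
  then obtain e where e: "\<And>i. e i > 0" "\<And>i. ball (x i) (e i) \<subseteq> X i" by metis
  \<comment> \<open>The entry 1 keeps the set non-empty when \<open>n\<close> is 0. Finitely many
    radii suffice because \<open>x\<close> and \<open>y\<close> both vanish from index
    \<open>n\<close> on.\<close>
  define d where "d = Min (insert 1 (e ` {..<n}))"
  have "d > 0" using e by (auto simp: d_def)
  moreover have "y \<in> S" if y: "\<And>i. i < n \<Longrightarrow> \<bar>y i - x i\<bar> < d" "\<And>i. i \<ge> n \<Longrightarrow> y i = 0" for y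
  proof -
    have "y i \<in> X i" for i
    proof (cases "i < n")
      case True
      then have "d \<le> e i" by (auto simp: d_def)
      with y(1)[OF True] have "y i \<in> ball (x i) (e i)" by (auto simp: dist_real_def)
      then show ?thesis using e(2) by blast
    next
      case False
      then have "y i = x i" using y openin_Euclidean_spaceD[OF assms] by auto
      then show ?thesis using X by (auto simp: PiE_iff)
    qed
    then show ?thesis using X y T by (auto simp: PiE_iff)
  qed
  ultimately show thesis by (rule that)
qed

lemma eventually_fun_upd_mem:
  assumes "openin (Euclidean_space n) S" "x \<in> S" "i < n"
  shows "\<forall>\<^sub>F t in nhds (x i). x(i := t) \<in> S"
proof -
  obtain e where e: "e > 0"
    "\<And>y. (\<And>i. i < n \<Longrightarrow> \<bar>y i - x i\<bar> < e) \<Longrightarrow> (\<And>i. i \<ge> n \<Longrightarrow> y i = 0) \<Longrightarrow> y \<in> S"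
    using openin_Euclidean_space_box[OF assms(1,2)] by blast
  have "x(i := t) \<in> S" if "dist t (x i) < e" for t
    using that e(1) assms openin_Euclidean_spaceD[OF assms(1,2)]
    by (intro e(2)) (auto simp: dist_real_def)
  then show ?thesis using e(1) eventually_nhds_metric by blast
qed

lemma has_real_derivative_line_cong:
  assumes "openin (Euclidean_space n) S" "x \<in> S" "i < n" "\<And>y. y \<in> S \<Longrightarrow> f y = g y"
  shows "((\<lambda>t. f (x(i := t))) has_real_derivative d) (at (x i)) \<longleftrightarrow>
         ((\<lambda>t. g (x(i := t))) has_real_derivative d) (at (x i))"
  by (rule DERIV_cong_ev[OF refl _ refl])
    (use eventually_fun_upd_mem[OF assms(1-3)] assms(4) in \<open>auto elim: eventually_mono\<close>)

lemma pd_eqI: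
  "((\<lambda>t. f (x(i := t))) has_real_derivative d) (at (x i)) \<Longrightarrow> pd i f x = d"
  unfolding pd_def by (rule DERIV_imp_deriv)

lemma pd_cong:
  assumes "openin (Euclidean_space n) S" "x \<in> S" "i < n" "\<And>y. y \<in> S \<Longrightarrow> f y = g y"
  shows "pd i f x = pd i g x"
  unfolding pd_def deriv_def using has_real_derivative_line_cong[of n S x i f g] assms by simp

lemma pds_cong:
  assumes "openin (Euclidean_space n) S" "set is \<subseteq> {..<n}" "\<And>y. y \<in> S \<Longrightarrow> f y = g y" "x \<in> S"
  shows "pds is f x = pds is g x"
  using assms(2,4)
proof (induction "is" arbitrary: x)
  case (Cons i "is")
  then show ?case using pd_cong[OF assms(1), of x i "pds is f" "pds is g"] by auto
qed (use assms in auto)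

text \<open>The differentiability part of \<open>smooth_funs\<close>, without the extension by zero:
  coordinates, constants and compositions do not vanish off \<open>S\<close>.\<close>

definition smooth_on :: "nat \<Rightarrow> (nat \<Rightarrow> real) set \<Rightarrow> ((nat \<Rightarrow> real) \<Rightarrow> real) \<Rightarrow> bool" where
  "smooth_on n S f \<longleftrightarrow> (\<forall>is. set is \<subseteq> {..<n} \<longrightarrow> continuous_on S (pds is f) \<and>
     (\<forall>i<n. \<forall>x\<in>S. (\<lambda>t. pds is f (x(i := t))) differentiable (at (x i))))"

lemma smooth_funs_iff: "f \<in> smooth_funs n S \<longleftrightarrow> smooth_on n S f \<and> (\<forall>x. x \<notin> S \<longrightarrow> f x = 0)"
  by (simp add: smooth_funs_def smooth_on_def)

text \<open>Smoothness is an infinite tower of conditions; a set \<open>X\<close> of continuous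
  functions that is closed under partial derivatives serves as an invariant for all of them.
  Agreement on \<open>S\<close> suffices, because near a point of the relatively open set
  \<open>S\<close> a coordinate line stays in \<open>S\<close>.\<close>

lemma smooth_on_coinduct:
  assumes S: "openin (Euclidean_space n) S" and "f \<in> X"
    and X: "\<And>f. f \<in> X \<Longrightarrow> continuous_on S f"
      "\<And>f i. f \<in> X \<Longrightarrow> i < n \<Longrightarrow>
        \<exists>g\<in>X. \<forall>x\<in>S. ((\<lambda>t. f (x(i := t))) has_real_derivative g x) (at (x i))"
  shows "smooth_on n S f"
proof -
  have *: "\<exists>g\<in>X. \<forall>x\<in>S. pds is f x = g x" if "set is \<subseteq> {..<n}" for "is"
    using that
  proof (induction "is")
    case Nil then show ?case using assms(2) by auto
  next
    case (Cons i "is")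
    then obtain g where g: "g \<in> X" "\<And>x. x \<in> S \<Longrightarrow> pds is f x = g x" by auto
    have "i < n" using Cons by auto
    from X(2)[OF g(1) this] obtain h where
      h: "h \<in> X" "\<And>x. x \<in> S \<Longrightarrow> ((\<lambda>t. g (x(i := t))) has_real_derivative h x) (at (x i))" by blast
    have "pds (i # is) f x = h x" if "x \<in> S" for x
      using pd_cong[OF S that \<open>i < n\<close>, of "pds is f" g] pd_eqI[of g x i, OF h(2)[OF that]] g(2) by simp
    then show ?case using h by blast
  qed
  show ?thesis unfolding smooth_on_def
  proof (intro allI impI conjI ballI)
    fix "is" assume "set is \<subseteq> {..<n}"
    from *[OF this] obtain g where g: "g \<in> X" "\<And>x. x \<in> S \<Longrightarrow> pds is f x = g x" by auto
    then show "continuous_on S (pds is f)" using X(1)[OF g(1)] by (simp cong: continuous_on_cong)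
    fix i x assume "i < n" "x \<in> S"
    with X(2)[OF g(1)] obtain d where "((\<lambda>t. g (x(i := t))) has_real_derivative d) (at (x i))" by blast
    then have "((\<lambda>t. pds is f (x(i := t))) has_real_derivative d) (at (x i))"
      using has_real_derivative_line_cong[of n S x i "pds is f" g] S \<open>x \<in> S\<close> \<open>i < n\<close> g(2) by simp
    then show "(\<lambda>t. pds is f (x(i := t))) differentiable (at (x i))"
      using real_differentiable_def by blast
  qed
qed

lemma smooth_on_imp_continuous_on: "smooth_on n S f \<Longrightarrow> continuous_on S f"
  by (auto simp: smooth_on_def dest: spec[of _ "[]"])

lemma smooth_on_has_pd:
  assumes "smooth_on n S f" "i < n" "x \<in> S"
  shows "((\<lambda>t. f (x(i := t))) has_real_derivative pd i f x) (at (x i))"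
proof -
  have "(\<lambda>t. f (x(i := t))) differentiable (at (x i))"
    using assms by (auto simp: smooth_on_def dest: spec[of _ "[]"])
  then show ?thesis
    unfolding pd_def using DERIV_imp_deriv real_differentiable_def by metis
qed

lemma smooth_on_pds:
  assumes "smooth_on n S f" "set is \<subseteq> {..<n}"
  shows "smooth_on n S (pds is f)"
  unfolding smooth_on_def
proof (intro allI impI)
  fix js assume "set js \<subseteq> {..<n}"
  then show "continuous_on S (pds js (pds is f)) \<and>
    (\<forall>i<n. \<forall>x\<in>S. (\<lambda>t. pds js (pds is f) (x(i := t))) differentiable (at (x i)))"
    using assms spec[of _ "js @ is", OF assms(1)[unfolded smooth_on_def]] by simp
qed

lemma smooth_on_pd: "smooth_on n S f \<Longrightarrow> i < n \<Longrightarrow> smooth_on n S (pd i f)"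
  using smooth_on_pds[of n S f "[i]"] by simp

lemma smooth_on_cong:
  assumes "openin (Euclidean_space n) S" "\<And>x. x \<in> S \<Longrightarrow> f x = g x" "smooth_on n S f"
  shows "smooth_on n S g"
proof (rule smooth_on_coinduct[where X = "{g. \<exists>f. smooth_on n S f \<and> (\<forall>x\<in>S. f x = g x)}"])
  fix g i assume "g \<in> {g. \<exists>f. smooth_on n S f \<and> (\<forall>x\<in>S. f x = g x)}" "i < n"
  then obtain f where f: "smooth_on n S f" "\<And>x. x \<in> S \<Longrightarrow> f x = g x" by auto
  have "\<forall>x\<in>S. ((\<lambda>t. g (x(i := t))) has_real_derivative pd i f x) (at (x i))"
    using smooth_on_has_pd[OF f(1) \<open>i < n\<close>] has_real_derivative_line_cong[of n S _ i f g] assms(1) \<open>i < n\<close> f(2) by simp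
  then show "\<exists>h\<in>{g. \<exists>f. smooth_on n S f \<and> (\<forall>x\<in>S. f x = g x)}.
      \<forall>x\<in>S. ((\<lambda>t. g (x(i := t))) has_real_derivative h x) (at (x i))"
    using smooth_on_pd[OF f(1) \<open>i < n\<close>] by blast
qed (use assms in \<open>auto cong: continuous_on_cong dest: smooth_on_imp_continuous_on\<close>)

lemma pds_zero: "pds is (\<lambda>x. 0) = (\<lambda>x. 0)"
  by (induction "is") (auto simp: pd_def)

lemma smooth_on_const:
  assumes "openin (Euclidean_space n) S"
  shows "smooth_on n S (\<lambda>x. c)"
  by (rule smooth_on_coinduct[OF assms, where X = "{\<lambda>x. c | c. True}"])
    (auto intro!: exI[of _ "\<lambda>_. 0"])

lemma smooth_on_coordinate:
  assumes S: "openin (Euclidean_space n) S"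
  shows "smooth_on n S (\<lambda>x. x i)"
proof (rule smooth_on_coinduct[OF assms, where X = "{\<lambda>x. c | c. True} \<union> {\<lambda>x. x i | i. True}"])
  fix f :: "(nat \<Rightarrow> real) \<Rightarrow> real" and j
  assume "f \<in> {\<lambda>x. c | c. True} \<union> {\<lambda>x. x i | i. True}"
  then show "\<exists>g\<in>{\<lambda>x. c |c. True} \<union> {\<lambda>x. x i |i. True}.
      \<forall>x\<in>S. ((\<lambda>t. f (x(j := t))) has_real_derivative g x) (at (x j))"
  proof (elim UnE)
    assume "f \<in> {\<lambda>x. x i | i. True}"
    then obtain i where i: "f = (\<lambda>x. x i)" by blast
    have "\<forall>x\<in>S. ((\<lambda>t. f (x(j := t))) has_real_derivative (if i = j then 1 else 0)) (at (x j))"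
      unfolding i by auto
    then show ?thesis by (intro bexI[of _ "\<lambda>_. if i = j then 1 else 0"]) auto
  qed (auto intro!: bexI[of _ "\<lambda>_. 0"])
qed (auto intro: continuous_on_subset[OF continuous_on_product_coordinates])

lemma smooth_on_add:
  assumes S: "openin (Euclidean_space n) S" and "smooth_on n S f" "smooth_on n S g"
  shows "smooth_on n S (\<lambda>x. f x + g x)"
proof (rule smooth_on_coinduct[OF S, where X = "{\<lambda>x. f x + g x | f g. smooth_on n S f \<and> smooth_on n S g}"])
  fix h i assume "h \<in> {\<lambda>x. f x + g x | f g. smooth_on n S f \<and> smooth_on n S g}" "i < n"
  then obtain f g where h: "h = (\<lambda>x. f x + g x)" "smooth_on n S f" "smooth_on n S g" by blast
  show "\<exists>g\<in>{\<lambda>x. f x + g x | f g. smooth_on n S f \<and> smooth_on n S g}.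
      \<forall>x\<in>S. ((\<lambda>t. h (x(i := t))) has_real_derivative g x) (at (x i))"
    by (intro bexI[of _ "\<lambda>x. pd i f x + pd i g x"])
      (use h \<open>i < n\<close> in \<open>auto intro!: derivative_intros smooth_on_has_pd smooth_on_pd\<close>)
qed (use assms in \<open>auto intro!: continuous_intros intro: smooth_on_imp_continuous_on\<close>)

lemma smooth_on_sum:
  assumes S: "openin (Euclidean_space n) S" and "\<And>a. a \<in> A \<Longrightarrow> smooth_on n S (f a)"
  shows "smooth_on n S (\<lambda>x. \<Sum>a\<in>A. f a x)"
  using assms(2) by (induction A rule: infinite_finite_induct)
    (auto intro!: smooth_on_add smooth_on_const S)

lemma smooth_on_mult:
  assumes S: "openin (Euclidean_space n) S" and "smooth_on n S f" "smooth_on n S g"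
  shows "smooth_on n S (\<lambda>x. f x * g x)"
proof -
  \<comment> \<open>A single product is not stable under the Leibniz rule, but finite sums of
    products are.\<close>
  define X where "X = {\<lambda>x. \<Sum>p\<leftarrow>fs. fst p x * snd p x | fs.
    \<forall>p\<in>set fs. smooth_on n S (fst p) \<and> smooth_on n S (snd p)}"
  show ?thesis
  proof (rule smooth_on_coinduct[OF S, where X = X])
    have "(\<lambda>x. f x * g x) = (\<lambda>x. \<Sum>p\<leftarrow>[(f, g)]. fst p x * snd p x)" by simp
    then show "(\<lambda>x. f x * g x) \<in> X" unfolding X_def
      using assms by (intro CollectI exI[of _ "[(f, g)]"]) auto
  next
    fix h assume "h \<in> X"
    then obtain fs where fs: "h = (\<lambda>x. \<Sum>p\<leftarrow>fs. fst p x * snd p x)"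
      "\<forall>p\<in>set fs. smooth_on n S (fst p) \<and> smooth_on n S (snd p)" unfolding X_def by blast
    show "continuous_on S h" unfolding fs(1) using fs(2)
      by (induction fs) (auto intro!: continuous_on_add continuous_on_mult intro: smooth_on_imp_continuous_on)
    fix i assume "i < n"
    define D where "D = (\<lambda>fs. concat (map (\<lambda>p. [(pd i (fst p), snd p), (fst p, pd i (snd p))]) fs))"
    have "((\<lambda>t. \<Sum>p\<leftarrow>fs. fst p (x(i := t)) * snd p (x(i := t))) has_real_derivative
        (\<Sum>p\<leftarrow>D fs. fst p x * snd p x)) (at (x i))" if "x \<in> S" for x
      using fs(2)
    proof (induction fs)
      case (Cons a fs)
      have a: "smooth_on n S (fst a)" "smooth_on n S (snd a)" using Cons.prems by auto
      have IH: "((\<lambda>t. \<Sum>p\<leftarrow>fs. fst p (x(i := t)) * snd p (x(i := t))) has_real_derivative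
        (\<Sum>p\<leftarrow>D fs. fst p x * snd p x)) (at (x i))" by (rule Cons.IH) (use Cons.prems in simp)
      have "(\<Sum>p\<leftarrow>D (a # fs). fst p x * snd p x) =
          pd i (fst a) x * snd a x + pd i (snd a) x * fst a x + (\<Sum>p\<leftarrow>D fs. fst p x * snd p x)"
        by (simp add: D_def)
      then show ?case
        using DERIV_add[OF DERIV_mult[OF smooth_on_has_pd[OF a(1) \<open>i < n\<close> that]
            smooth_on_has_pd[OF a(2) \<open>i < n\<close> that]] IH]
        by (simp only: fun_upd_triv list.map sum_list.Cons)
    qed (auto simp: D_def)
    moreover have "\<forall>p\<in>set (D fs). smooth_on n S (fst p) \<and> smooth_on n S (snd p)"
      using fs(2) \<open>i < n\<close> by (auto simp: D_def smooth_on_pd)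
    ultimately show "\<exists>g\<in>X. \<forall>x\<in>S. ((\<lambda>t. h (x(i := t))) has_real_derivative g x) (at (x i))"
      unfolding X_def fs(1)
      by (intro bexI[of _ "\<lambda>x. \<Sum>p\<leftarrow>D fs. fst p x * snd p x"] CollectI exI[of _ "D fs"] conjI refl) blast+
  qed
qed

lemma smooth_on_diff:
  assumes S: "openin (Euclidean_space n) S" and "smooth_on n S f" "smooth_on n S g"
  shows "smooth_on n S (\<lambda>x. f x - g x)"
  using smooth_on_add[OF S assms(2) smooth_on_mult[OF S smooth_on_const[OF S, of "-1"] assms(3)]]
  by simp

section \<open>Mean value theorem, chain rule and composition\<close>

lemma mvt_closed_segment:
  fixes f :: "real \<Rightarrow> real"
  assumes "\<And>x. x \<in> closed_segment a b \<Longrightarrow> (f has_real_derivative f' x) (at x)"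
  shows "\<exists>z\<in>closed_segment a b. f b - f a = f' z * (b - a)"
proof -
  consider "a = b" | "a < b" | "b < a" by linarith
  then show ?thesis
  proof cases
    case 2
    then obtain z where "a < z" "z < b" "f b - f a = (b - a) * f' z"
      using assms MVT2[of a b f f'] by (auto simp: closed_segment_eq_real_ivl)
    then show ?thesis by (intro bexI[of _ z]) (auto simp: closed_segment_eq_real_ivl)
  next
    case 3
    then obtain z where "b < z" "z < a" "f a - f b = (a - b) * f' z"
      using assms MVT2[of b a f f'] by (auto simp: closed_segment_eq_real_ivl)
    then show ?thesis by (intro bexI[of _ z]) (auto simp: closed_segment_eq_real_ivl algebra_simps)
  qed auto
qed

text \<open>The increment of \<open>v\<close> along the curve is cut into increments in single
  coordinates. The mean value theorem turns each into a partial derivative at an intermediate point,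
  and continuity of the partial derivatives gives the limit of the difference quotient.\<close>

lemma smooth_on_chain_rule:
  assumes S: "openin (Euclidean_space n) S" and v: "smooth_on n S v"
    and \<gamma>: "\<And>j. j < n \<Longrightarrow> ((\<lambda>t. \<gamma> t j) has_real_derivative d j) (at t0)"
    and mem: "\<forall>\<^sub>F t in nhds t0. \<gamma> t \<in> S"
  shows "((\<lambda>t. v (\<gamma> t)) has_real_derivative (\<Sum>j<n. pd j v (\<gamma> t0) * d j)) (at t0)"
proof -
  define z where "z = \<gamma> t0"
  have "z \<in> S" unfolding z_def using mem eventually_nhds_x_imp_x by metis
  obtain e where e: "e > 0"
    "\<And>y. (\<And>i. i < n \<Longrightarrow> \<bar>y i - z i\<bar> < e) \<Longrightarrow> (\<And>i. i \<ge> n \<Longrightarrow> y i = 0) \<Longrightarrow> y \<in> S"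
    using openin_Euclidean_space_box[OF S \<open>z \<in> S\<close>] by blast
  have lim: "((\<lambda>t. \<gamma> t j) \<longlongrightarrow> z j) (at t0)" if "j < n" for j
    unfolding z_def using DERIV_isCont[OF \<gamma>[OF that]] by (simp add: isCont_def)
  have near: "\<forall>\<^sub>F t in at t0. \<gamma> t \<in> S \<and> (\<forall>j\<in>{..<n}. \<bar>\<gamma> t j - z j\<bar> < e)"
  proof (intro eventually_conj eventually_ball_finite ballI)
    show "\<forall>\<^sub>F t in at t0. \<gamma> t \<in> S" using mem by (simp add: eventually_nhds_conv_at)
    fix j assume "j \<in> {..<n}"
    with tendstoD[OF lim e(1)] show "\<forall>\<^sub>F t in at t0. \<bar>\<gamma> t j - z j\<bar> < e"
      by (simp add: dist_real_def)
  qed auto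
  \<comment> \<open>Mixed points: the first \<open>m\<close> coordinates come from the curve, the
    others from \<open>z\<close>. Consecutive ones differ in coordinate \<open>m\<close> only, and
    all of them lie in the box around \<open>z\<close> that is contained in
    \<open>S\<close>.\<close>
  define H where "H = (\<lambda>m t i. if i < m then \<gamma> t i else z i)"
  have z0: "z i = 0" if "i \<ge> n" for i using openin_Euclidean_spaceD[OF S \<open>z \<in> S\<close>] that by auto
  have "\<exists>\<xi>. \<forall>m<n. \<xi> m \<in> closed_segment (z m) (\<gamma> t m) \<and> (H m t)(m := \<xi> m) \<in> S \<and>
      v (H (Suc m) t) - v (H m t) = pd m v ((H m t)(m := \<xi> m)) * (\<gamma> t m - z m)"
    if t: "\<gamma> t \<in> S" "\<And>j. j < n \<Longrightarrow> \<bar>\<gamma> t j - z j\<bar> < e" for t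
  proof -
    have "\<exists>\<xi>. \<xi> \<in> closed_segment (z m) (\<gamma> t m) \<and> (H m t)(m := \<xi>) \<in> S \<and>
      v (H (Suc m) t) - v (H m t) = pd m v ((H m t)(m := \<xi>)) * (\<gamma> t m - z m)" if "m < n" for m
    proof -
      have in_S: "(H m t)(m := s) \<in> S" if s: "s \<in> closed_segment (z m) (\<gamma> t m)" for s
      proof (rule e(2))
        fix i assume "i < n"
        have "\<bar>s - z m\<bar> \<le> \<bar>\<gamma> t m - z m\<bar>" using s by (auto simp: closed_segment_eq_real_ivl split: if_splits)
        with t(2)[OF \<open>i < n\<close>] t(2)[OF \<open>m < n\<close>] e(1) show "\<bar>((H m t)(m := s)) i - z i\<bar> < e"
          by (auto simp: H_def)
      qed (use that \<open>m < n\<close> z0 in \<open>auto simp: H_def\<close>)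
      have D: "((\<lambda>s. v ((H m t)(m := s))) has_real_derivative pd m v ((H m t)(m := s))) (at s)"
        if "s \<in> closed_segment (z m) (\<gamma> t m)" for s
        using smooth_on_has_pd[OF v \<open>m < n\<close> in_S[OF that]] by simp
      have "(H m t)(m := \<gamma> t m) = H (Suc m) t" "(H m t)(m := z m) = H m t"
        by (auto simp: H_def fun_eq_iff)
      with mvt_closed_segment[of "z m" "\<gamma> t m" "\<lambda>s. v ((H m t)(m := s))", OF D] in_S show ?thesis
        by auto
    qed
    then show ?thesis by metis
  qed
  then obtain \<xi> where \<xi>: "\<And>t m. \<gamma> t \<in> S \<Longrightarrow> (\<And>j. j < n \<Longrightarrow> \<bar>\<gamma> t j - z j\<bar> < e) \<Longrightarrow> m < n \<Longrightarrow>
      \<xi> t m \<in> closed_segment (z m) (\<gamma> t m) \<and> (H m t)(m := \<xi> t m) \<in> S \<and>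
      v (H (Suc m) t) - v (H m t) = pd m v ((H m t)(m := \<xi> t m)) * (\<gamma> t m - z m)"
    by metis
  define q where "q = (\<lambda>m t. pd m v ((H m t)(m := \<xi> t m)))"
  have q_lim: "(q m \<longlongrightarrow> pd m v z) (at t0)" if "m < n" for m
    unfolding q_def
  proof (rule continuous_on_tendsto_compose[of S "pd m v" _ z])
    show "continuous_on S (pd m v)" using smooth_on_imp_continuous_on smooth_on_pd[OF v that] by blast
    show "z \<in> S" by fact
    show "\<forall>\<^sub>F t in at t0. (H m t)(m := \<xi> t m) \<in> S"
      using near by eventually_elim (use \<xi> that in auto)
    show "((\<lambda>t. (H m t)(m := \<xi> t m)) \<longlongrightarrow> z) (at t0)"
      unfolding tendsto_fun_iff
    proof
      fix i
      have "((\<lambda>t. \<xi> t m) \<longlongrightarrow> z m) (at t0)"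
      proof (rule metric_tendsto_imp_tendsto[OF lim[OF that]])
        show "\<forall>\<^sub>F t in at t0. dist (\<xi> t m) (z m) \<le> dist (\<gamma> t m) (z m)"
          using near
        proof eventually_elim
          case (elim t)
          then have "\<xi> t m \<in> closed_segment (z m) (\<gamma> t m)" using \<xi> that by auto
          then show ?case by (auto simp: closed_segment_eq_real_ivl dist_real_def split: if_splits)
        qed
      qed
      then show "((\<lambda>t. ((H m t)(m := \<xi> t m)) i) \<longlongrightarrow> z i) (at t0)"
        using lim[of i] that by (cases "i = m"; cases "i < m") (auto simp: H_def)
    qed
  qed
  have "((\<lambda>t. \<Sum>m<n. q m t * ((\<gamma> t m - z m) / (t - t0))) \<longlongrightarrow> (\<Sum>j<n. pd j v z * d j)) (at t0)"
    using q_lim \<gamma> by (intro tendsto_intros) (auto simp: z_def has_field_derivative_iff)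
  moreover have "\<forall>\<^sub>F t in at t0. (\<Sum>m<n. q m t * ((\<gamma> t m - z m) / (t - t0))) = (v (\<gamma> t) - v z) / (t - t0)"
    using near
  proof eventually_elim
    case (elim t)
    have "H 0 t = z" "H n t = \<gamma> t"
      using openin_Euclidean_spaceD[OF S, of "\<gamma> t"] elim z0 by (auto simp: H_def fun_eq_iff)
    then have "v (\<gamma> t) - v z = (\<Sum>m<n. v (H (Suc m) t) - v (H m t))"
      using sum_lessThan_telescope[of "\<lambda>m. v (H m t)" n] by simp
    also have "\<dots> = (\<Sum>m<n. q m t * (\<gamma> t m - z m))"
      using \<xi> elim by (intro sum.cong) (auto simp: q_def)
    finally show ?case by (simp add: sum_divide_distrib)
  qed
  ultimately show ?thesis
    unfolding has_field_derivative_iff z_def using tendsto_cong by force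
qed

text \<open>The invariant consists of finite sums of products of a smooth \<open>u\<close> with some
  \<open>w\<close> composed with \<open>b\<close>. Differentiating such a product gives one summand
  from \<open>u\<close> and, by the chain rule, one for each coordinate of \<open>b\<close>, again
  of the same shape.\<close>

lemma smooth_on_compose:
  assumes S: "openin (Euclidean_space n) S" and T: "openin (Euclidean_space m) T"
    and b: "\<And>j. j < m \<Longrightarrow> smooth_on n S (\<lambda>x. b x j)" "b ` S \<subseteq> T"
    and v: "smooth_on m T v"
  shows "smooth_on n S (\<lambda>x. v (b x))"
proof -
  have b0: "b x j = 0" if "x \<in> S" "j \<ge> m" for x j
    using openin_Euclidean_spaceD[OF T, of "b x"] that b(2) by auto
  have cont_b: "continuous_on S b"
  proof (rule continuous_on_coordinatewise_then_product)
    fix j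
    show "continuous_on S (\<lambda>x. b x j)"
    proof (cases "j < m")
      case True then show ?thesis using b(1) smooth_on_imp_continuous_on by blast
    next
      case False
      then have "continuous_on S (\<lambda>x. b x j) \<longleftrightarrow> continuous_on S (\<lambda>x. 0::real)"
        using b0 by (intro continuous_on_cong) auto
      then show ?thesis by simp
    qed
  qed
  define X where "X = {\<lambda>x. \<Sum>p\<leftarrow>fs. fst p x * snd p (b x) | fs.
    \<forall>p\<in>set fs. smooth_on n S (fst p) \<and> smooth_on m T (snd p)}"
  show ?thesis
  proof (rule smooth_on_coinduct[OF S, where X = X])
    have "(\<lambda>x. v (b x)) = (\<lambda>x. \<Sum>p\<leftarrow>[(\<lambda>_. 1, v)]. fst p x * snd p (b x))" by simp
    then show "(\<lambda>x. v (b x)) \<in> X" unfolding X_def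
      using v smooth_on_const[OF S] by (intro CollectI exI[of _ "[(\<lambda>_. 1, v)]"]) auto
  next
    fix h assume "h \<in> X"
    then obtain fs where fs: "h = (\<lambda>x. \<Sum>p\<leftarrow>fs. fst p x * snd p (b x))"
      "\<forall>p\<in>set fs. smooth_on n S (fst p) \<and> smooth_on m T (snd p)" unfolding X_def by blast
    have "continuous_on S (\<lambda>x. w (b x))" if "smooth_on m T w" for w
      using continuous_on_compose2[OF smooth_on_imp_continuous_on[OF that] cont_b] b(2) by auto
    with fs(2) show "continuous_on S h" unfolding fs(1)
      by (induction fs) (auto intro!: continuous_on_add continuous_on_mult intro: smooth_on_imp_continuous_on)
    fix i assume "i < n"
    define D where "D = (\<lambda>fs. concat (map (\<lambda>p. (pd i (fst p), snd p) #
       map (\<lambda>j. (\<lambda>x. fst p x * pd i (\<lambda>x. b x j) x, pd j (snd p))) [0..<m]) fs))"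
    have "((\<lambda>t. \<Sum>p\<leftarrow>fs. fst p (x(i := t)) * snd p (b (x(i := t)))) has_real_derivative
        (\<Sum>p\<leftarrow>D fs. fst p x * snd p (b x))) (at (x i))" if "x \<in> S" for x
      using fs(2)
    proof (induction fs)
      case (Cons a fs)
      obtain u w where a: "a = (u, w)" by force
      with Cons have uw: "smooth_on n S u" "smooth_on m T w" by auto
      have "((\<lambda>t. w (b (x(i := t)))) has_real_derivative
          (\<Sum>j<m. pd j w (b (x(i := x i))) * pd i (\<lambda>x. b x j) x)) (at (x i))"
      proof (rule smooth_on_chain_rule[OF T uw(2)])
        show "\<forall>\<^sub>F t in nhds (x i). b (x(i := t)) \<in> T"
          using eventually_fun_upd_mem[OF S that \<open>i < n\<close>] by eventually_elim (use b(2) in auto)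
      qed (use smooth_on_has_pd[OF b(1) \<open>i < n\<close> that] in auto)
      then have w: "((\<lambda>t. w (b (x(i := t)))) has_real_derivative
          (\<Sum>j<m. pd j w (b x) * pd i (\<lambda>x. b x j) x)) (at (x i))" by simp
      have u: "((\<lambda>t. u (x(i := t))) has_real_derivative pd i u x) (at (x i))"
        using smooth_on_has_pd[OF uw(1) \<open>i < n\<close> that] .
      have IH: "((\<lambda>t. \<Sum>p\<leftarrow>fs. fst p (x(i := t)) * snd p (b (x(i := t)))) has_real_derivative
        (\<Sum>p\<leftarrow>D fs. fst p x * snd p (b x))) (at (x i))" by (rule Cons.IH) (use Cons.prems in simp)
      have "(\<Sum>p\<leftarrow>D (a # fs). fst p x * snd p (b x)) = pd i u x * w (b x) +
          (\<Sum>j<m. pd j w (b x) * pd i (\<lambda>x. b x j) x) * u x + (\<Sum>p\<leftarrow>D fs. fst p x * snd p (b x))"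
        by (simp add: D_def a o_def interv_sum_list_conv_sum_set_nat atLeast0LessThan
            sum_distrib_left sum_distrib_right mult_ac)
      moreover have "((\<lambda>t. u (x(i := t)) * w (b (x(i := t))) + (\<Sum>p\<leftarrow>fs. fst p (x(i := t)) * snd p (b (x(i := t)))))
        has_real_derivative pd i u x * w (b x) +
          (\<Sum>j<m. pd j w (b x) * pd i (\<lambda>x. b x j) x) * u x + (\<Sum>p\<leftarrow>D fs. fst p x * snd p (b x))) (at (x i))"
        using DERIV_add[OF DERIV_mult[OF u w] IH] by (simp only: fun_upd_triv)
      ultimately show ?case by (simp only: a list.map sum_list.Cons fst_conv snd_conv)
    qed (auto simp: D_def)
    moreover have "\<forall>p\<in>set (D fs). smooth_on n S (fst p) \<and> smooth_on m T (snd p)"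
      using fs(2) \<open>i < n\<close> b(1) by (auto simp: D_def intro!: smooth_on_pd smooth_on_mult S)
    ultimately show "\<exists>g\<in>X. \<forall>x\<in>S. ((\<lambda>t. h (x(i := t))) has_real_derivative g x) (at (x i))"
      unfolding X_def fs(1)
      by (intro bexI[of _ "\<lambda>x. \<Sum>p\<leftarrow>D fs. fst p x * snd p (b x)"] CollectI exI[of _ "D fs"] conjI refl) blast+
  qed
qed

section \<open>Stability of graded functions under pull-back\<close>

declare split_paired_All [simp del] split_paired_Ex [simp del]

lemma finite_bounded_multisets:
  assumes "finite A"
  shows "finite {M. set_mset M \<subseteq> A \<and> size M \<le> n}"
proof (rule finite_subset[OF _ finite_imageI[OF finite_lists_length_le[OF assms, of n], of mset]])
  show "{M. set_mset M \<subseteq> A \<and> size M \<le> n} \<subseteq> mset ` {xs. set xs \<subseteq> A \<and> length xs \<le> n}"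
  proof
    fix M assume M: "M \<in> {M. set_mset M \<subseteq> A \<and> size M \<le> n}"
    obtain xs where "mset xs = M" using ex_mset by blast
    with M show "M \<in> mset ` {xs. set xs \<subseteq> A \<and> length xs \<le> n}" by force
  qed
qed

lemma sum_list_map_sorted_list_of_multiset:
  "(\<Sum>a\<leftarrow>sorted_list_of_multiset M. f a) = (\<Sum>a\<in>#M. f a)"
  for f :: "_ \<Rightarrow> 'a::comm_monoid_add"
  by (metis mset_map mset_sorted_list_of_multiset sum_mset_sum_list)

lemma sum_list_map_sorted_list_of_set:
  "finite J \<Longrightarrow> (\<Sum>a\<leftarrow>sorted_list_of_set J. f a) = (\<Sum>a\<in>J. f a)"
  for f :: "_ \<Rightarrow> 'a::comm_monoid_add"
  using sum.distinct_set_conv_list[of "sorted_list_of_set J" f] by simp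

lemma finite_snd_monomials: "M \<in> monomials U \<Longrightarrow> finite (snd M)"
  by (auto simp: monomials_def dest: finite_subset[OF _ finite_lessThan])

lemma graded_chart_openin: "graded_chart U \<Longrightarrow> openin (Euclidean_space (base_dim U)) (base U)"
  by (simp add: graded_chart_def)

lemma smooth_funs_zero: "openin (Euclidean_space n) S \<Longrightarrow> (\<lambda>x. 0) \<in> smooth_funs n S"
  by (simp add: smooth_funs_iff smooth_on_const)

text \<open>Grouping monomials by degree recovers the homogeneous summands from the coefficients, so
  all that remains of the direct sum is the finiteness of the set of degrees. Membership can then be
  tested coefficient by coefficient.\<close>

lemma graded_funs_iff:
  assumes U: "graded_chart U"
  shows "f \<in> graded_funs U \<longleftrightarrow>
    (\<forall>M. f M \<in> smooth_funs (base_dim U) (base U)) \<and>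
    (\<forall>M. f M \<noteq> (\<lambda>x. 0) \<longrightarrow> M \<in> monomials U) \<and>
    finite (mdeg U ` {M. f M \<noteq> (\<lambda>x. 0)})" (is "?l \<longleftrightarrow> ?r")
proof
  assume ?l
  then obtain A h where A: "f = (\<lambda>M x. \<Sum>k\<in>A. h k M x)" "finite A"
    "\<And>k. k \<in> A \<Longrightarrow> h k \<in> graded_funs_hom U k"
    unfolding graded_funs_def by blast
  have ex: "\<exists>k\<in>A. h k M \<noteq> (\<lambda>x. 0)" if "f M \<noteq> (\<lambda>x. 0)" for M
  proof (rule ccontr)
    assume "\<not> (\<exists>k\<in>A. h k M \<noteq> (\<lambda>x. 0))"
    then have "f M = (\<lambda>x. 0)" unfolding A(1) by (intro ext sum.neutral) auto
    with that show False by simp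
  qed
  have "mdeg U ` {M. f M \<noteq> (\<lambda>x. 0)} \<subseteq> A"
    using ex A(3) by (fastforce simp: graded_funs_hom_def)
  moreover have "f M \<in> smooth_funs (base_dim U) (base U)" for M
    using A(3) graded_chart_openin[OF U] unfolding A(1)
    by (auto simp: smooth_funs_iff graded_funs_hom_def intro!: smooth_on_sum sum.neutral)
  moreover have "M \<in> monomials U" if "f M \<noteq> (\<lambda>x. 0)" for M
    using ex[OF that] A(3) by (auto simp: graded_funs_hom_def)
  ultimately show ?r using finite_subset[OF _ \<open>finite A\<close>] by blast
next
  assume r: ?r
  define A where "A = mdeg U ` {M. f M \<noteq> (\<lambda>x. 0)}"
  define h where "h = (\<lambda>k M x. if mdeg U M = k then f M x else 0)"
  have "h k \<in> graded_funs_hom U k" if "k \<in> A" for k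
  proof -
    have "h k M = (if mdeg U M = k then f M else (\<lambda>x. 0))" for M by (auto simp: h_def)
    then show ?thesis
      using r smooth_funs_zero[OF graded_chart_openin[OF U]] by (auto simp: graded_funs_hom_def)
  qed
  moreover have "f = (\<lambda>M x. \<Sum>k\<in>A. h k M x)"
  proof (intro ext)
    fix M x
    show "f M x = (\<Sum>k\<in>A. h k M x)"
    proof (cases "f M = (\<lambda>x. 0)")
      case True
      then show ?thesis by (auto simp: h_def intro!: sum.neutral)
    next
      case False
      then have "mdeg U M \<in> A" by (auto simp: A_def)
      then show ?thesis using r by (simp add: h_def A_def)
    qed
  qed
  moreover have "finite A" using r by (simp add: A_def)
  ultimately show ?l unfolding graded_funs_def by blast
qed

lemma polynomial_funs_subset_graded_funs:
  "graded_chart U \<Longrightarrow> polynomial_funs U \<subseteq> graded_funs U"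
  by (auto simp: graded_funs_iff polynomial_funs_def)

lemma smooth_on_ser_mult:
  assumes S: "openin (Euclidean_space n) S"
    and "\<And>M. smooth_on n S (f M)" "\<And>M. smooth_on n S (g M)"
  shows "smooth_on n S (ser_mult f g M)"
  using assms by (cases M)
    (auto simp: ser_mult_def intro!: smooth_on_sum smooth_on_mult smooth_on_const)

lemma smooth_on_ser_prod:
  assumes S: "openin (Euclidean_space n) S"
    and "\<And>f M. f \<in> set fs \<Longrightarrow> smooth_on n S (f M)"
  shows "smooth_on n S (ser_prod fs M)"
  using assms(2)
proof (induction fs arbitrary: M)
  case Nil
  then show ?case using smooth_on_const[OF S, of "if M = ({#}, {}) then 1 else 0"]
    by (simp add: ser_prod_def ser_one_def)
next
  case (Cons f fs)
  then show ?case by (auto simp: ser_prod_def intro!: smooth_on_ser_mult S)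
qed

lemma ser_mult_nonzeroE:
  assumes "ser_mult f g (I, J) x \<noteq> 0"
  obtains I' J' I'' J'' where "f (I', J') x \<noteq> 0" "g (I'', J'') x \<noteq> 0"
    "I = I' + I''" "J = J' \<union> J''" "J' \<inter> J'' = {}" "finite J"
proof -
  \<comment> \<open>For infinite \<open>J\<close> the sum over \<open>Pow J\<close> is 0 by
    convention.\<close>
  have fin: "finite J"
  proof (rule ccontr)
    assume "infinite J"
    then have "ser_mult f g (I, J) x = 0" by (simp add: ser_mult_def)
    with assms show False by simp
  qed
  obtain I' where I': "I' \<subseteq># I"
    "(\<Sum>J'\<in>Pow J. koszul_sign J' (J - J') * f (I', J') x * g (I - I', J - J') x) \<noteq> 0"
    using assms unfolding ser_mult_def by (auto elim: sum.not_neutral_contains_not_neutral)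
  then obtain J' where "J' \<subseteq> J" "f (I', J') x \<noteq> 0" "g (I - I', J - J') x \<noteq> 0"
    by (auto elim: sum.not_neutral_contains_not_neutral)
  with I' fin show thesis by (intro that[of I' J' "I - I'" "J - J'"]) auto
qed

section \<open>Degree and order of vanishing at a point\<close>

definition msize :: "monomial \<Rightarrow> nat" where
  "msize M = size (fst M) + card (snd M)"

text \<open>The number \<open>r\<close> is a lower bound for the order of vanishing: at
  \<open>x\<close> the series lies in the \<open>r\<close>-th power of the ideal generated by the
  coordinates of non-zero degree. Evaluation at a point matches the pointwise definition of the
  pull-back.\<close>

definition graded_at :: "chart \<Rightarrow> (nat \<Rightarrow> real) \<Rightarrow> int \<Rightarrow> nat \<Rightarrow> series \<Rightarrow> bool" where
  "graded_at U x d r f \<longleftrightarrow> (\<forall>M. f M x \<noteq> 0 \<longrightarrow> M \<in> monomials U \<and> mdeg U M = d \<and> r \<le> msize M)"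

lemma graded_at_ser_mult:
  assumes f: "graded_at U x d r f" and g: "graded_at U x d' r' g"
  shows "graded_at U x (d + d') (r + r') (ser_mult f g)"
  unfolding graded_at_def
proof (intro allI impI)
  fix M assume nz: "ser_mult f g M x \<noteq> 0"
  obtain I J where M: "M = (I, J)" by force
  from nz[unfolded M] obtain I' J' I'' J'' where
    *: "f (I', J') x \<noteq> 0" "g (I'', J'') x \<noteq> 0" "I = I' + I''" "J = J' \<union> J''" "J' \<inter> J'' = {}" "finite J"
    by (rule ser_mult_nonzeroE)
  have "finite J'" "finite J''" using * by auto
  then have "sum c J = sum c J' + sum c J''" for c :: "nat \<Rightarrow> int"
    using * by (simp add: sum.union_disjoint)
  moreover have "card J = card J' + card J''" using * \<open>finite J'\<close> \<open>finite J''\<close> by (simp add: card_Un_disjoint)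
  ultimately show "M \<in> monomials U \<and> mdeg U M = d + d' \<and> r + r' \<le> msize M"
    using f[unfolded graded_at_def, rule_format, OF *(1)] g[unfolded graded_at_def, rule_format, OF *(2)]
    by (auto simp: M * monomials_def mdeg_def msize_def)
qed

lemma graded_at_ser_prod:
  assumes "list_all2 (\<lambda>d f. graded_at U x d 1 f) ds fs"
  shows "graded_at U x (sum_list ds) (length ds) (ser_prod fs)"
  using assms
proof induction
  case Nil
  show ?case by (auto simp: graded_at_def ser_prod_def ser_one_def monomials_def mdeg_def)
next
  case (Cons d ds f fs)
  then show ?case using graded_at_ser_mult[of U x d 1 f "sum_list ds" "length ds" "ser_prod fs"]
    by (simp add: ser_prod_def)
qed

lemma graded_at_hom:
  assumes "f \<in> graded_funs_hom U d" "f ({#}, {}) x = 0"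
  shows "graded_at U x d 1 f"
  unfolding graded_at_def
proof (intro allI impI)
  fix M assume nz: "f M x \<noteq> 0"
  then have "f M \<noteq> (\<lambda>x. 0)" by auto
  then have M: "M \<in> monomials U" "mdeg U M = d" using assms by (auto simp: graded_funs_hom_def)
  have "M \<noteq> ({#}, {})" using nz assms by auto
  then have "msize M \<noteq> 0" using finite_snd_monomials[OF M(1)] by (cases M) (auto simp: msize_def)
  then show "M \<in> monomials U \<and> mdeg U M = d \<and> 1 \<le> msize M" using M by simp
qed

text \<open>The constant monomial has degree 0 and cannot occur in degree \<open>d\<close>. Hence
  the pull-back of a coordinate of non-zero degree has order at least 1.\<close>

lemma graded_at_hom_nonzero:
  assumes "f \<in> graded_funs_hom U d" "d \<noteq> 0"
  shows "graded_at U x d 1 f"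
proof (rule graded_at_hom[OF assms(1)])
  have "mdeg U ({#}, {}) = 0" by (simp add: mdeg_def)
  then show "f ({#}, {}) x = 0" using assms by (fastforce simp: graded_funs_hom_def fun_eq_iff)
qed

context
  fixes U U' :: chart and \<phi> :: components
  assumes U: "graded_chart U" and U': "graded_chart U'" and \<phi>: "degree_preserving U U' \<phi>"
begin

lemma graded_at_comp_power:
  assumes K: "K \<in> monomials U'"
  shows "graded_at U x (mdeg U' K) (msize K) (comp_power \<phi> K)"
proof -
  obtain I J where IJ: "K = (I, J)" by force
  have fin: "finite J" using finite_snd_monomials[OF K] IJ by simp
  define ds where "ds = map (\<lambda>a. even_degs U' ! a) (sorted_list_of_multiset I) @
    map (\<lambda>j. odd_degs U' ! j) (sorted_list_of_set J)"
  have "graded_at U x (even_degs U' ! a) 1 (comp_even \<phi> a)" if "a \<in># I" for a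
  proof -
    have "a < length (even_degs U')" using K IJ that by (auto simp: monomials_def)
    then show ?thesis using U' \<phi>
      by (intro graded_at_hom_nonzero) (auto simp: graded_chart_def degree_preserving_def)
  qed
  moreover have "graded_at U x (odd_degs U' ! j) 1 (comp_odd \<phi> j)" if "j \<in> J" for j
  proof -
    have j: "j < length (odd_degs U')" using K IJ that by (auto simp: monomials_def)
    then have "odd (odd_degs U' ! j)" using U' by (auto simp: graded_chart_def)
    then show ?thesis using j \<phi>
      by (intro graded_at_hom_nonzero) (auto simp: degree_preserving_def)
  qed
  ultimately have "graded_at U x (sum_list ds) (length ds) (comp_power \<phi> (I, J))"
    unfolding comp_power_def split ds_def using fin
    by (intro graded_at_ser_prod list_all2_appendI)
      (auto simp: list_all2_map1 list_all2_map2 simp: list_all2_same)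
  moreover have "sum_list ds = mdeg U' K"
    by (simp add: ds_def IJ mdeg_def sum_list_map_sorted_list_of_multiset
        sum_list_map_sorted_list_of_set fin)
  moreover have "length ds = msize K"
    using size_mset[of "sorted_list_of_multiset I"] by (simp add: ds_def IJ msize_def)
  ultimately show ?thesis by (simp add: IJ)
qed

lemma nil_part_eq: "nil_part \<phi> i M = (if M = ({#}, {}) then (\<lambda>x. 0) else comp_base \<phi> i M)"
  by (simp add: nil_part_def)

lemma graded_at_nil_power:
  assumes "set_mset L \<subseteq> {..<base_dim U'}"
  shows "graded_at U x 0 (size L) (nil_power \<phi> L)"
proof -
  have "graded_at U x 0 1 (nil_part \<phi> i)" if "i < base_dim U'" for i
  proof -
    have "comp_base \<phi> i \<in> graded_funs_hom U 0" using \<phi> that by (simp add: degree_preserving_def)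
    then have "nil_part \<phi> i \<in> graded_funs_hom U 0"
      using smooth_funs_zero[OF graded_chart_openin[OF U]]
      by (auto simp: graded_funs_hom_def nil_part_eq)
    then show ?thesis by (rule graded_at_hom) (simp add: nil_part_def)
  qed
  then have "list_all2 (\<lambda>d f. graded_at U x d 1 f) (replicate (size L) 0)
      (map (nil_part \<phi>) (sorted_list_of_multiset L))"
    using assms by (auto simp: list_all2_conv_all_nth subset_iff simp flip: set_sorted_list_of_multiset size_mset)
  from graded_at_ser_prod[OF this] show ?thesis by (simp add: nil_power_def sum_list_replicate)
qed

text \<open>A term indexed by \<open>(K, L)\<close> has order at least
  \<open>size L + msize K\<close>, so only these pairs can reach \<open>M\<close>. The set does not
  depend on the point, which makes a coefficient of the pull-back one finite sum of smooth functions
  over the whole base.\<close>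

definition bounded_pairs :: "monomial \<Rightarrow> (monomial \<times> nat multiset) set" where
  "bounded_pairs M = {(K, L). K \<in> monomials U' \<and> set_mset L \<subseteq> {..<base_dim U'} \<and> msize K + size L \<le> msize M}"

lemma finite_bounded_pairs: "finite (bounded_pairs M)"
proof (rule finite_subset)
  show "bounded_pairs M \<subseteq> ({I. set_mset I \<subseteq> {..<length (even_degs U')} \<and> size I \<le> msize M} \<times>
      Pow {..<length (odd_degs U')}) \<times> {L. set_mset L \<subseteq> {..<base_dim U'} \<and> size L \<le> msize M}"
    by (auto simp: bounded_pairs_def monomials_def msize_def)
qed (intro finite_cartesian_product finite_bounded_multisets; simp)

lemma graded_at_pullback_term:
  assumes "K \<in> monomials U'" "set_mset L \<subseteq> {..<base_dim U'}"
  shows "graded_at U x (mdeg U' K) (size L + msize K) (ser_mult (nil_power \<phi> L) (comp_power \<phi> K))"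
  using graded_at_ser_mult[OF graded_at_nil_power[OF assms(2)] graded_at_comp_power[OF assms(1)]] by simp

lemma pullback_eq_finite_sum:
  assumes "x \<in> base U"
  shows "pullback U U' \<phi> g M x = (\<Sum>(K, L)\<in>bounded_pairs M.
    1 / multi_fact L * pds (sorted_list_of_multiset L) (g K) (body_map U' \<phi> x) *
         ser_mult (nil_power \<phi> L) (comp_power \<phi> K) M x)"
proof -
  have vanish: "ser_mult (nil_power \<phi> L) (comp_power \<phi> K) M x = 0"
    if "K \<in> monomials U'" "set_mset L \<subseteq> {..<base_dim U'}" "(K, L) \<notin> bounded_pairs M" for K L
  proof (rule ccontr)
    assume "ser_mult (nil_power \<phi> L) (comp_power \<phi> K) M x \<noteq> 0"
    with graded_at_pullback_term[OF that(1,2), of x] have "size L + msize K \<le> msize M"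
      by (auto simp: graded_at_def)
    with that show False by (simp add: bounded_pairs_def)
  qed
  define T where "T = (\<lambda>(K, L). 1 / multi_fact L * pds (sorted_list_of_multiset L) (g K) (body_map U' \<phi> x) *
         ser_mult (nil_power \<phi> L) (comp_power \<phi> K) M x)"
  have "infsum T (monomials U' \<times> {L. set_mset L \<subseteq> {..<base_dim U'}}) = infsum T (bounded_pairs M)"
  proof (rule infsum_cong_neutral)
    fix p assume "p \<in> monomials U' \<times> {L. set_mset L \<subseteq> {..<base_dim U'}} - bounded_pairs M"
    then show "T p = 0" using vanish by (cases p) (simp add: T_def)
  qed (auto simp: bounded_pairs_def)
  then show ?thesis using assms finite_bounded_pairs by (simp add: pullback_def T_def infsum_finite)
qed

lemma smooth_on_pullback:
  assumes g: "\<And>K. g K \<in> smooth_funs (base_dim U') (base U')"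
  shows "smooth_on (base_dim U) (base U) (pullback U U' \<phi> g M)"
proof (rule smooth_on_cong[OF graded_chart_openin[OF U] pullback_eq_finite_sum[symmetric]])
  note S = graded_chart_openin[OF U]
  have b: "smooth_on (base_dim U) (base U) (comp_base \<phi> i M)" if "i < base_dim U'" for i M
    using \<phi> that by (auto simp: degree_preserving_def graded_funs_hom_def smooth_funs_iff)
  have body: "smooth_on (base_dim U) (base U) (\<lambda>x. w (body_map U' \<phi> x))"
    if "smooth_on (base_dim U') (base U') w" for w
    by (rule smooth_on_compose[OF S graded_chart_openin[OF U'] _ _ that])
      (use b \<phi> in \<open>auto simp: body_map_def degree_preserving_def\<close>)
  have nil: "smooth_on (base_dim U) (base U) (nil_power \<phi> L M)" if L: "set_mset L \<subseteq> {..<base_dim U'}" for L M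
    unfolding nil_power_def
  proof (rule smooth_on_ser_prod[OF S])
    fix f M assume "f \<in> set (map (nil_part \<phi>) (sorted_list_of_multiset L))"
    then obtain i where "i < base_dim U'" "f = nil_part \<phi> i" using L by (auto simp: subset_iff)
    then show "smooth_on (base_dim U) (base U) (f M)"
      using b smooth_on_const[OF S, of 0] by (cases "M = ({#}, {})") (auto simp: nil_part_def)
  qed
  have comp: "smooth_on (base_dim U) (base U) (comp_power \<phi> K M)" if K: "K \<in> monomials U'" for K M
  proof -
    obtain I J where IJ: "K = (I, J)" by force
    have fin: "finite J" using finite_snd_monomials[OF K] IJ by simp
    show ?thesis unfolding IJ comp_power_def split
    proof (rule smooth_on_ser_prod[OF S])
      fix f M assume "f \<in> set (map (comp_even \<phi>) (sorted_list_of_multiset I) @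
        map (comp_odd \<phi>) (sorted_list_of_set J))"
      with K IJ fin have "\<exists>d. f \<in> graded_funs_hom U d"
        using \<phi> by (auto simp: degree_preserving_def monomials_def subset_iff)
      then show "smooth_on (base_dim U) (base U) (f M)"
        by (auto simp: graded_funs_hom_def smooth_funs_iff)
    qed
  qed
  show "smooth_on (base_dim U) (base U) (\<lambda>x. \<Sum>(K, L)\<in>bounded_pairs M.
    1 / multi_fact L * pds (sorted_list_of_multiset L) (g K) (body_map U' \<phi> x) *
         ser_mult (nil_power \<phi> L) (comp_power \<phi> K) M x)"
  proof (intro smooth_on_sum[OF S])
    fix p assume "p \<in> bounded_pairs M"
    then obtain K L where p: "p = (K, L)" "K \<in> monomials U'" "set_mset L \<subseteq> {..<base_dim U'}"
      by (auto simp: bounded_pairs_def)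
    have "smooth_on (base_dim U) (base U) (\<lambda>x. 1 / multi_fact L *
        pds (sorted_list_of_multiset L) (g K) (body_map U' \<phi> x) *
         ser_mult (nil_power \<phi> L) (comp_power \<phi> K) M x)"
      using nil[OF p(3)] comp[OF p(2)] g p(3)
      by (intro smooth_on_mult[OF S] smooth_on_const[OF S] smooth_on_ser_mult[OF S] body smooth_on_pds)
        (auto simp: smooth_funs_iff)
    then show "smooth_on (base_dim U) (base U) (\<lambda>x. case p of (K, L) \<Rightarrow> 1 / multi_fact L *
        pds (sorted_list_of_multiset L) (g K) (body_map U' \<phi> x) *
         ser_mult (nil_power \<phi> L) (comp_power \<phi> K) M x)"
      by (simp add: p)
  qed
qed

text \<open>Nilpotent parts have degree 0 and coordinates keep their degree, so the term of
  \<open>(K, L)\<close> is homogeneous of the degree of \<open>K\<close>. The degrees in the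
  pull-back thus occur in \<open>g\<close> already, and they remain finite in number.\<close>

lemma pullback_nonzeroE:
  assumes "pullback U U' \<phi> g M \<noteq> (\<lambda>x. 0)"
  obtains K where "g K \<noteq> (\<lambda>x. 0)" "M \<in> monomials U" "mdeg U M = mdeg U' K"
proof -
  obtain x where x: "pullback U U' \<phi> g M x \<noteq> 0" using assms by auto
  then have "x \<in> base U" by (auto simp: pullback_def split: if_splits)
  with x obtain K L where KL: "(K, L) \<in> bounded_pairs M"
    "pds (sorted_list_of_multiset L) (g K) (body_map U' \<phi> x) \<noteq> 0"
    "ser_mult (nil_power \<phi> L) (comp_power \<phi> K) M x \<noteq> 0"
    unfolding pullback_eq_finite_sum[OF \<open>x \<in> base U\<close>] by (force elim: sum.not_neutral_contains_not_neutral)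
  have "g K \<noteq> (\<lambda>x. 0)" using KL(2) by (metis pds_zero)
  moreover have "M \<in> monomials U" "mdeg U M = mdeg U' K"
    using graded_at_pullback_term[of K L x] KL by (auto simp: bounded_pairs_def graded_at_def)
  ultimately show thesis by (rule that)
qed

lemma pullback_graded_funs:
  assumes "g \<in> graded_funs U'"
  shows "pullback U U' \<phi> g \<in> graded_funs U"
  unfolding graded_funs_iff[OF U]
proof (intro conjI allI impI)
  have g: "\<And>K. g K \<in> smooth_funs (base_dim U') (base U')" "finite (mdeg U' ` {K. g K \<noteq> (\<lambda>x. 0)})"
    using assms by (simp_all add: graded_funs_iff[OF U'])
  show "pullback U U' \<phi> g M \<in> smooth_funs (base_dim U) (base U)" for M
    using smooth_on_pullback[OF g(1)] by (simp add: smooth_funs_iff pullback_def)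
  show "M \<in> monomials U" if "pullback U U' \<phi> g M \<noteq> (\<lambda>x. 0)" for M
    using that by (rule pullback_nonzeroE)
  have "mdeg U ` {M. pullback U U' \<phi> g M \<noteq> (\<lambda>x. 0)} \<subseteq> mdeg U' ` {K. g K \<noteq> (\<lambda>x. 0)}"
    by (auto elim!: pullback_nonzeroE)
  then show "finite (mdeg U ` {M. pullback U U' \<phi> g M \<noteq> (\<lambda>x. 0)})"
    using g(2) finite_subset by blast
qed

end

lemma morphism_stable_graded_funs: "morphism_stable graded_funs"
  unfolding morphism_stable_def class_morphism_def using pullback_graded_funs by blast

section \<open>Borel's lemma with parameters\<close>

lemma pds_add:
  assumes W: "openin (Euclidean_space n) W" and "smooth_on n W f" "smooth_on n W g"
    and "set is \<subseteq> {..<n}" "x \<in> W"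
  shows "pds is (\<lambda>x. f x + g x) x = pds is f x + pds is g x"
  using assms(4,5)
proof (induction "is" arbitrary: x)
  case (Cons i "is")
  then have i: "i < n" and is_sub: "set is \<subseteq> {..<n}" by auto
  have "pds (i # is) (\<lambda>x. f x + g x) x = pd i (\<lambda>x. pds is f x + pds is g x) x"
    using pd_cong[OF W Cons.prems(2) i, of "pds is (\<lambda>x. f x + g x)" "\<lambda>x. pds is f x + pds is g x"]
      Cons.IH[OF is_sub] by simp
  also have "\<dots> = pd i (pds is f) x + pd i (pds is g) x"
    by (intro pd_eqI DERIV_add smooth_on_has_pd[OF smooth_on_pds[OF _ is_sub] i Cons.prems(2)] assms)
  finally show ?case by simp
qed simp

lemma pds_diff:
  assumes W: "openin (Euclidean_space n) W" and f: "smooth_on n W f" and g: "smooth_on n W g"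
    and "set is \<subseteq> {..<n}" "x \<in> W"
  shows "pds is (\<lambda>x. f x - g x) x = pds is f x - pds is g x"
  using pds_add[OF W g smooth_on_diff[OF W f g] assms(4,5)] by simp

lemma open_box: "open {y :: nat \<Rightarrow> real. \<forall>i<n. \<bar>y i - x i\<bar> < e}"
proof -
  have "{y. \<forall>i<n. \<bar>y i - x i\<bar> < e} = (\<Inter>i\<in>{..<n}. {y. \<bar>y i - x i\<bar> < e})" by auto
  also have "open \<dots>"
    by (intro open_INT ballI open_Collect_less continuous_intros continuous_on_product_coordinates) simp
  finally show ?thesis .
qed

text \<open>Each point has a neighbourhood on which the terms are eventually dominated, up to any order of
  differentiation; by the Weierstrass test the series may be differentiated term by term.\<close>
lemma smooth_on_suminf:
  assumes W: "openin (Euclidean_space n) W" and h: "\<And>k. smooth_on n W (h k)"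
    and bound: "\<And>x. x \<in> W \<Longrightarrow> \<exists>e>0. \<exists>k0. \<forall>k\<ge>k0. \<forall>y\<in>W. (\<forall>i<n. \<bar>y i - x i\<bar> < e) \<longrightarrow>
      (\<forall>is. set is \<subseteq> {..<n} \<longrightarrow> length is < k \<longrightarrow> \<bar>pds is (h k) y\<bar> \<le> (1/2) ^ k)"
  shows "smooth_on n W (\<lambda>x. \<Sum>k. h k x)"
    and "set is \<subseteq> {..<n} \<Longrightarrow> x \<in> W \<Longrightarrow> pds is (\<lambda>x. \<Sum>k. h k x) x = (\<Sum>k. pds is (h k) x)"
proof -
  have geom: "summable (\<lambda>k. (1/2) ^ k :: real)" by (simp add: summable_geometric)
  \<comment> \<open>The estimate on the term of index \<open>k\<close> covers orders below
    \<open>k\<close> only; a fixed order is therefore covered by all but finitely many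
    terms.\<close>
  have bound_is: "\<exists>e>0. \<forall>\<^sub>F k in sequentially. \<forall>y\<in>W \<inter> {y. \<forall>i<n. \<bar>y i - x i\<bar> < e}.
      norm (pds is (h k) y) \<le> (1/2) ^ k"
    if x: "x \<in> W" and "is": "set is \<subseteq> {..<n}" for x "is"
  proof -
    obtain e k0 where e: "e > 0" "\<forall>k\<ge>k0. \<forall>y\<in>W. (\<forall>i<n. \<bar>y i - x i\<bar> < e) \<longrightarrow>
      (\<forall>is. set is \<subseteq> {..<n} \<longrightarrow> length is < k \<longrightarrow> \<bar>pds is (h k) y\<bar> \<le> (1/2) ^ k)"
      using bound[OF x] by blast
    have "\<forall>\<^sub>F k in sequentially. k \<ge> k0 \<and> k > length is"
      by (intro eventually_conj eventually_ge_at_top eventually_gt_at_top)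
    then have "\<forall>\<^sub>F k in sequentially. \<forall>y\<in>W \<inter> {y. \<forall>i<n. \<bar>y i - x i\<bar> < e}. norm (pds is (h k) y) \<le> (1/2) ^ k"
      by eventually_elim (use e(2) "is" in auto)
    with e(1) show ?thesis by blast
  qed
  have cont: "continuous_on W (\<lambda>x. \<Sum>k. pds is (h k) x)" if "is": "set is \<subseteq> {..<n}" for "is"
    unfolding continuous_on_eq_continuous_within
  proof
    fix x assume x: "x \<in> W"
    obtain e where e: "e > 0" "\<forall>\<^sub>F k in sequentially. \<forall>y\<in>W \<inter> {y. \<forall>i<n. \<bar>y i - x i\<bar> < e}.
      norm (pds is (h k) y) \<le> (1/2) ^ k" using bound_is[OF x "is"] by blast
    let ?B = "{y. \<forall>i<n. \<bar>y i - x i\<bar> < e}"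
    have "continuous_on (W \<inter> ?B) (\<lambda>x. \<Sum>k. pds is (h k) x)"
    proof (rule uniform_limit_theorem[OF _ Weierstrass_m_test_ev[OF e(2) geom]])
      show "\<forall>\<^sub>F m in sequentially. continuous_on (W \<inter> ?B) (\<lambda>x. \<Sum>k<m. pds is (h k) x)"
        by (intro always_eventually allI continuous_on_sum
          continuous_on_subset[OF smooth_on_imp_continuous_on[OF smooth_on_pds[OF h "is"]]]) auto
    qed simp
    then have "continuous (at x within W \<inter> ?B) (\<lambda>x. \<Sum>k. pds is (h k) x)"
      using x e(1) by (simp add: continuous_on_eq_continuous_within)
    moreover have "at x within W \<inter> ?B = at x within W"
      using e(1) by (intro at_within_nhd[OF _ open_box[of n x e]]) auto
    ultimately show "continuous (at x within W) (\<lambda>x. \<Sum>k. pds is (h k) x)" by simp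
  qed
  have deriv: "((\<lambda>t. \<Sum>k. pds is (h k) (x(i := t))) has_real_derivative (\<Sum>k. pds (i # is) (h k) x)) (at (x i))"
    if x: "x \<in> W" and "is": "set is \<subseteq> {..<n}" and i: "i < n" for x i "is"
  proof -
    have is': "set (i # is) \<subseteq> {..<n}" using "is" i by auto
    obtain e1 where e1: "e1 > 0" "\<forall>\<^sub>F k in sequentially. \<forall>y\<in>W \<inter> {y. \<forall>i<n. \<bar>y i - x i\<bar> < e1}.
      norm (pds (i # is) (h k) y) \<le> (1/2) ^ k" using bound_is[OF x is'] by blast
    obtain e2 where e2: "e2 > 0" "\<forall>\<^sub>F k in sequentially. \<forall>y\<in>W \<inter> {y. \<forall>i<n. \<bar>y i - x i\<bar> < e2}.
      norm (pds is (h k) y) \<le> (1/2) ^ k" using bound_is[OF x "is"] by blast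
    obtain e3 where e3: "e3 > 0"
      "\<And>y. (\<And>i. i < n \<Longrightarrow> \<bar>y i - x i\<bar> < e3) \<Longrightarrow> (\<And>i. i \<ge> n \<Longrightarrow> y i = 0) \<Longrightarrow> y \<in> W"
      using openin_Euclidean_space_box[OF W x] by blast
    \<comment> \<open>\<open>e1\<close> dominates the differentiated terms and \<open>e3\<close>
      keeps the coordinate line in \<open>W\<close>. The undifferentiated series has to converge at
      the centre only, which the estimate for \<open>e2\<close> provides.\<close>
    define e where "e = min e1 e3"
    have "e > 0" using e1 e3 by (simp add: e_def)
    define I where "I = {x i - e<..<x i + e}"
    have in_W: "x(i := t) \<in> W" "\<forall>j<n. \<bar>(x(i := t)) j - x j\<bar> < e1" if "t \<in> I" for t
      using that i openin_Euclidean_spaceD[OF W x] e3(1) e1(1)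
      by (auto simp: I_def e_def intro!: e3(2))
    have "((\<lambda>t. \<Sum>k. pds is (h k) (x(i := t))) has_real_derivative (\<Sum>k. pds (i # is) (h k) (x(i := x i)))) (at (x i))"
    proof (rule has_field_derivative_series'(2)[where S = I and x0 = "x i" and
          f = "\<lambda>k t. pds is (h k) (x(i := t))" and f' = "\<lambda>k t. pds (i # is) (h k) (x(i := t))"])
      show "convex I" by (simp add: I_def)
      show "x i \<in> I" using \<open>e > 0\<close> by (simp add: I_def)
      then show "x i \<in> interior I" by (simp add: I_def interior_open)
      show "((\<lambda>t. pds is (h k) (x(i := t))) has_real_derivative pds (i # is) (h k) (x(i := t))) (at t within I)"
        if "t \<in> I" for k t
        using smooth_on_has_pd[OF smooth_on_pds[OF h "is"] i in_W(1)[OF that], of k]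
        by (auto intro: has_field_derivative_at_within)
      have "\<forall>\<^sub>F k in sequentially. \<forall>t\<in>I. norm (pds (i # is) (h k) (x(i := t))) \<le> (1/2) ^ k"
        using e1(2) by eventually_elim (use in_W in blast)
      then show "uniformly_convergent_on I (\<lambda>m t. \<Sum>k<m. pds (i # is) (h k) (x(i := t)))"
        by (rule Weierstrass_m_test'_ev[OF _ geom])
      have "\<forall>\<^sub>F k in sequentially. norm (pds is (h k) (x(i := x i))) \<le> (1/2) ^ k"
        using e2(2) by eventually_elim (use x e2(1) in auto)
      then show "summable (\<lambda>k. pds is (h k) (x(i := x i)))"
        by (rule summable_comparison_test_ev[OF _ geom])
    qed
    then show ?thesis by simp
  qed
  show "smooth_on n W (\<lambda>x. \<Sum>k. h k x)"
  proof (rule smooth_on_coinduct[OF W, where X = "{\<lambda>x. \<Sum>k. pds is (h k) x | is. set is \<subseteq> {..<n}}"])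
    show "(\<lambda>x. \<Sum>k. h k x) \<in> {\<lambda>x. \<Sum>k. pds is (h k) x | is. set is \<subseteq> {..<n}}"
      by (intro CollectI exI[of _ "[]"]) auto
    fix f i assume "f \<in> {\<lambda>x. \<Sum>k. pds is (h k) x | is. set is \<subseteq> {..<n}}" and i: "i < n"
    then obtain "is" where f: "f = (\<lambda>x. \<Sum>k. pds is (h k) x)" "set is \<subseteq> {..<n}" by blast
    show "\<exists>g\<in>{\<lambda>x. \<Sum>k. pds is (h k) x | is. set is \<subseteq> {..<n}}.
        \<forall>x\<in>W. ((\<lambda>t. f (x(i := t))) has_real_derivative g x) (at (x i))"
      unfolding f(1) by (intro bexI[of _ "\<lambda>x. \<Sum>k. pds (i # is) (h k) x"] ballI deriv CollectI
          exI[of _ "i # is"] conjI refl f(2) i) (use f(2) i in auto)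
  qed (use cont in blast)
  show "pds is (\<lambda>x. \<Sum>k. h k x) x = (\<Sum>k. pds is (h k) x)" if "set is \<subseteq> {..<n}" "x \<in> W"
    using that
  proof (induction "is" arbitrary: x)
    case (Cons i "is")
    then have i: "i < n" and "is": "set is \<subseteq> {..<n}" by auto
    have "pds (i # is) (\<lambda>x. \<Sum>k. h k x) x = pd i (\<lambda>x. \<Sum>k. pds is (h k) x) x"
      using pd_cong[OF W Cons.prems(2) i, of "pds is (\<lambda>x. \<Sum>k. h k x)" "\<lambda>x. \<Sum>k. pds is (h k) x"]
        Cons.IH[OF "is"] by simp
    also have "\<dots> = (\<Sum>k. pds (i # is) (h k) x)"
      by (rule pd_eqI) (rule deriv[OF Cons.prems(2) "is" i])
    finally show ?case .
  qed simp
qed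

section \<open>Exhaustion by compact sets and uniform estimates\<close>

definition compact_core :: "nat \<Rightarrow> (nat \<Rightarrow> real) set \<Rightarrow> nat \<Rightarrow> (nat \<Rightarrow> real) set" where
  "compact_core n S k = {x. (\<forall>i\<ge>n. x i = 0) \<and> (\<forall>i<n. \<bar>x i\<bar> \<le> real k) \<and>
     (\<forall>y. (\<forall>i\<ge>n. y i = 0) \<and> (\<forall>i<n. \<bar>y i - x i\<bar> < 1 / real (Suc k)) \<longrightarrow> y \<in> S)}"

lemma compact_core_subset: "compact_core n S k \<subseteq> S"
  by (auto simp: compact_core_def)

lemma compact_compact_core: "compact (compact_core n S k)"
proof -
  let ?P = "PiE UNIV (\<lambda>i. if i < n then {- real k..real k} else {0})"
  \<comment> \<open>Each point \<open>y\<close> outside \<open>S\<close> forbids an open cube around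
    it. What remains is an intersection of finite unions of closed sets.\<close>
  let ?C = "\<Inter>y\<in>{y. (\<forall>i\<ge>n. y i = 0) \<and> y \<notin> S}. \<Union>i\<in>{..<n}. {x. 1 / real (Suc k) \<le> \<bar>y i - x i\<bar>}"
  have "compactin (product_topology (\<lambda>i. euclideanreal) UNIV) ?P"
    by (subst compactin_PiE) auto
  then have "compact ?P" by (simp add: euclidean_product_topology)
  moreover have "closed ?C"
    by (intro closed_INT closed_UN ballI closed_Collect_le continuous_intros
        continuous_on_product_coordinates) auto
  ultimately have "compact (?P \<inter> ?C)" by (rule compact_Int_closed)
  also have "?P \<inter> ?C = compact_core n S k"
  proof (intro equalityI subsetI)
    fix x assume x: "x \<in> ?P \<inter> ?C"
    then have *: "x i \<in> (if i < n then {- real k..real k} else {0})" for i by (auto simp: PiE_iff)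
    have "y \<in> S" if "\<forall>i\<ge>n. y i = 0" "\<forall>i<n. \<bar>y i - x i\<bar> < 1 / real (Suc k)" for y
    proof (rule ccontr)
      assume "y \<notin> S"
      with x that(1) have "x \<in> (\<Union>i\<in>{..<n}. {x. 1 / real (Suc k) \<le> \<bar>y i - x i\<bar>})" by blast
      then show False using that(2) by (auto simp: not_less)
    qed
    moreover have "x i = 0" if "i \<ge> n" for i using *[of i] that by simp
    moreover have "\<bar>x i\<bar> \<le> real k" if "i < n" for i using *[of i] that by (simp add: abs_le_iff)
    ultimately show "x \<in> compact_core n S k" unfolding compact_core_def by blast
  next
    fix x assume x: "x \<in> compact_core n S k"
    then have *: "x i \<in> (if i < n then {- real k..real k} else {0})" for i
      by (auto simp: compact_core_def abs_le_iff)
    have "\<exists>i\<in>{..<n}. 1 / real (Suc k) \<le> \<bar>y i - x i\<bar>" if "\<forall>i\<ge>n. y i = 0" "y \<notin> S" for y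
    proof (rule ccontr)
      assume "\<not> ?thesis"
      then have "\<forall>i<n. \<bar>y i - x i\<bar> < 1 / real (Suc k)" by (auto simp: not_le)
      with x that show False unfolding compact_core_def by blast
    qed
    then have "x \<in> ?C" by blast
    moreover have "x \<in> ?P" using * by auto
    ultimately show "x \<in> ?P \<inter> ?C" by blast
  qed
  finally show ?thesis .
qed

text \<open>A box of half the radius of one contained in \<open>S\<close> lies in all late cores.
  This turns estimates on the cores into the local domination required by
  \<open>smooth_on_suminf\<close>.\<close>

lemma compact_core_nhd:
  assumes S: "openin (Euclidean_space n) S" and x: "x \<in> S"
  shows "\<exists>e>0. \<exists>k0. \<forall>k\<ge>k0. \<forall>y\<in>S. (\<forall>i<n. \<bar>y i - x i\<bar> < e) \<longrightarrow> y \<in> compact_core n S k"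
proof -
  obtain e where e: "e > 0"
    "\<And>y. (\<And>i. i < n \<Longrightarrow> \<bar>y i - x i\<bar> < e) \<Longrightarrow> (\<And>i. i \<ge> n \<Longrightarrow> y i = 0) \<Longrightarrow> y \<in> S"
    using openin_Euclidean_space_box[OF S x] by blast
  \<comment> \<open>Half of the radius is spent on the way from \<open>x\<close> to
    \<open>y\<close>, the other half on the way from \<open>y\<close> to a test point
    \<open>z\<close>.\<close>
  obtain k1 where k1: "1 / real (Suc k1) < e / 2"
    using e(1) reals_Archimedean[of "e / 2"] by (auto simp: inverse_eq_divide)
  obtain k2 where k2: "(\<Sum>i<n. \<bar>x i\<bar>) + e \<le> real k2" using real_arch_simple by blast
  have "y \<in> compact_core n S k" if k: "k \<ge> max k1 k2" and y: "y \<in> S" "\<forall>i<n. \<bar>y i - x i\<bar> < e / 2" for k y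
    unfolding compact_core_def
  proof (intro CollectI conjI allI impI)
    show "y i = 0" if "i \<ge> n" for i using openin_Euclidean_spaceD[OF S y(1) that] .
    show "\<bar>y i\<bar> \<le> real k" if "i < n" for i
    proof -
      have "\<bar>x i\<bar> \<le> (\<Sum>i<n. \<bar>x i\<bar>)" using that by (intro member_le_sum) auto
      moreover have "real k2 \<le> real k" using k by simp
      moreover have "\<bar>y i - x i\<bar> < e / 2" using y(2) that by blast
      ultimately show ?thesis using k2 e(1) by linarith
    qed
    fix z assume z: "(\<forall>i\<ge>n. z i = 0) \<and> (\<forall>i<n. \<bar>z i - y i\<bar> < 1 / real (Suc k))"
    have "1 / real (Suc k) \<le> 1 / real (Suc k1)" using k by (intro divide_left_mono) auto
    with k1 have k1': "1 / real (Suc k) < e / 2" by simp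
    show "z \<in> S"
    proof (rule e(2))
      fix i assume "i < n"
      with z y(2) have "\<bar>z i - y i\<bar> < 1 / real (Suc k)" "\<bar>y i - x i\<bar> < e / 2" by auto
      with k1' show "\<bar>z i - x i\<bar> < e" by linarith
    qed (use z in auto)
  qed
  then show ?thesis using e(1) by (intro exI[of _ "e/2"] conjI exI[of _ "max k1 k2"]) auto
qed

lemma compact_continuous_bound:
  fixes f :: "_ \<Rightarrow> real"
  assumes "compact K" "continuous_on K f"
  shows "\<exists>B. \<forall>x\<in>K. \<bar>f x\<bar> \<le> B"
  using compact_imp_bounded[OF compact_continuous_image[OF assms(2,1)]]
  by (auto simp: bounded_iff)

text \<open>Iterated antiderivatives of a rapid oscillation play the role of the usual cut-off monomials
  \<open>t\<^sup>k / k!\<close>: on a given interval, all derivatives of order less than \<open>k\<close> are small.\<close>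
lemma exists_small_jet:
  fixes T e :: real
  assumes "T \<ge> 0" "e > 0"
  shows "\<exists>D :: nat \<Rightarrow> real \<Rightarrow> real. (\<forall>m t. (D m has_real_derivative D (Suc m) t) (at t)) \<and>
    (\<forall>m<k. D m 0 = 0) \<and> D k 0 = 1 \<and> (\<forall>m<k. \<forall>t. \<bar>t\<bar> \<le> T \<longrightarrow> \<bar>D m t\<bar> \<le> e)"
  using assms(2)
proof (induction k arbitrary: e)
  case 0
  \<comment> \<open>No order lies below 0, so smallness is vacuous and only the value 1 at the
    origin matters.\<close>
  show ?case by (rule exI[of _ "\<lambda>m. exp"]) (auto intro!: derivative_eq_intros)
next
  case (Suc k)
  show ?case
  proof (cases "k = 0")
    case True
    \<comment> \<open>Amplitude \<open>1 / l\<close> against frequency \<open>l\<close>: the values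
      are bounded by \<open>e\<close> while the slope at 0 is 1. The phase \<open>m * pi / 2\<close>
      encodes repeated differentiation of the sine. This case stands apart because the function
      obtained for order 0 is not small, so integrating it would give no small
      antiderivative.\<close>
    define l where "l = 1 / e"
    have l: "l > 0" using Suc.prems by (simp add: l_def)
    define D where "D = (\<lambda>m t. l ^ m / l * sin (l * t + m * pi / 2))"
    have "(D m has_real_derivative D (Suc m) t) (at t)" for m t
    proof -
      have "sin (l * t + Suc m * pi / 2) = cos (l * t + m * pi / 2)"
        using sin_add[of "l * t + m * pi / 2" "pi / 2"] by (simp add: field_simps)
      then show ?thesis unfolding D_def
        by (auto intro!: derivative_eq_intros simp: algebra_simps)
    qed
    moreover have "\<bar>D 0 t\<bar> \<le> e" for t
      using mult_left_mono[OF abs_sin_le_one[of "l * t"], of e] Suc.prems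
      by (simp add: D_def l_def abs_mult)
    moreover have "D 0 0 = 0" "D 1 0 = 1" using l by (simp_all add: D_def)
    ultimately show ?thesis using True by (intro exI[of _ D]) auto
  next
    case False
    \<comment> \<open>One tolerance for two purposes: \<open>e'\<close> \<le> \<open>e\<close> for
      the orders taken over from the induction hypothesis, and \<open>e' * T\<close> \<le>
      \<open>e\<close> for the new antiderivative by the mean value theorem. The summand 1 covers
      \<open>T = 0\<close>.\<close>
    define e' where "e' = e / (T + 1)"
    have e': "e' > 0" "e' \<le> e" "e' * T \<le> e"
      using Suc.prems assms(1) by (auto simp: e'_def field_simps)
    from Suc.IH[OF e'(1)] obtain D :: "nat \<Rightarrow> real \<Rightarrow> real" where
      D: "\<And>m t. (D m has_real_derivative D (Suc m) t) (at t)" "\<And>m. m < k \<Longrightarrow> D m 0 = 0" "D k 0 = 1"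
        "\<And>m t. m < k \<Longrightarrow> \<bar>t\<bar> \<le> T \<Longrightarrow> \<bar>D m t\<bar> \<le> e'" by blast
    have "\<exists>F. \<forall>x. -\<infinity> < ereal x \<longrightarrow> ereal x < \<infinity> \<longrightarrow> (F has_vector_derivative D 0 x) (at x)"
      using DERIV_isCont[OF D(1)] by (intro einterval_antiderivative) auto
    then obtain F where F: "\<And>t. (F has_real_derivative D 0 t) (at t)"
      by (auto simp: has_real_derivative_iff_has_vector_derivative)
    define D' where "D' = (\<lambda>m. case m of 0 \<Rightarrow> \<lambda>t. F t - F 0 | Suc m \<Rightarrow> D m)"
    have small: "\<bar>F t - F 0\<bar> \<le> e" if "\<bar>t\<bar> \<le> T" for t
    proof -
      obtain z where z: "z \<in> closed_segment 0 t" "F t - F 0 = D 0 z * (t - 0)"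
        using mvt_closed_segment[of 0 t F "D 0"] F by blast
      have "\<bar>z\<bar> \<le> T" using z(1) that by (auto simp: closed_segment_eq_real_ivl split: if_splits)
      then have "\<bar>D 0 z\<bar> * \<bar>t\<bar> \<le> e' * T" using D(4)[of 0 z] False that e'(1) by (intro mult_mono) auto
      then show ?thesis using e' z(2) by (simp add: abs_mult)
    qed
    have "(D' m has_real_derivative D' (Suc m) t) (at t)" for m t
      using D(1) F by (cases m) (auto simp: D'_def intro!: derivative_eq_intros)
    moreover have "D' m 0 = 0" if "m < Suc k" for m
      using D(2) that by (cases m) (auto simp: D'_def)
    moreover have "\<bar>D' m t\<bar> \<le> e" if "m < Suc k" "\<bar>t\<bar> \<le> T" for m t
      using small[OF that(2)] D(4)[of "m - 1" t] e'(2) that by (cases m) (auto simp: D'_def)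
    moreover have "D' (Suc k) 0 = 1" using D(3) by (simp add: D'_def)
    ultimately show ?thesis by blast
  qed
qed

section \<open>Functions on the product with a line\<close>

definition cylinder :: "nat \<Rightarrow> (nat \<Rightarrow> real) set \<Rightarrow> (nat \<Rightarrow> real) set" where
  "cylinder n S = {p. (\<forall>i\<ge>Suc n. p i = 0) \<and> p(n := 0) \<in> S}"

lemma continuous_on_fun_upd: "continuous_on A (\<lambda>p :: nat \<Rightarrow> real. p(i := c))"
proof (rule continuous_on_coordinatewise_then_product)
  fix j
  show "continuous_on A (\<lambda>p. (p(i := c)) j)"
    by (cases "j = i") (auto intro: continuous_on_subset[OF continuous_on_product_coordinates])
qed

context
  fixes n :: nat and S :: "(nat \<Rightarrow> real) set"
  assumes S: "openin (Euclidean_space n) S"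
begin

lemma openin_cylinder: "openin (Euclidean_space (Suc n)) (cylinder n S)"
proof -
  obtain T where T: "open T" "S = T \<inter> {x. \<forall>i\<ge>n. x i = 0}"
    using openin_Euclidean_space_eq_Int[OF S] .
  have "open ((\<lambda>p. p(n := 0)) -` T)"
    using T(1) continuous_on_fun_upd by (rule open_vimage)
  moreover have "cylinder n S = ((\<lambda>p. p(n := 0)) -` T) \<inter> {x. \<forall>i\<ge>Suc n. x i = 0}"
    unfolding cylinder_def T(2) by (auto simp: Suc_le_eq)
  ultimately show ?thesis using openin_Euclidean_space_Int[of "(\<lambda>p. p(n := 0)) -` T" "Suc n"] by simp
qed

text \<open>Points of R^n vanish from index \<open>n\<close> on, so \<open>S\<close> is literally
  the zero section of the cylinder, and derivatives at y = 0 are values at points of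
  \<open>S\<close>.\<close>

lemma subset_cylinder: "S \<subseteq> cylinder n S"
proof
  fix x assume x: "x \<in> S"
  then have "x(n := 0) = x" using openin_Euclidean_spaceD[OF S x, of n] by auto
  with x show "x \<in> cylinder n S" using openin_Euclidean_spaceD[OF S x] by (simp add: cylinder_def)
qed

text \<open>Smoothness on the zero section asks for the same conditions on \<open>pds\<close> with
  fewer indices and at fewer points. It shows that derivatives in y at y = 0 are smooth in x, so
  that the defect left after some corrections is again an admissible coefficient.\<close>

lemma smooth_on_cylinder_restrict: "smooth_on (Suc n) (cylinder n S) f \<Longrightarrow> smooth_on n S f"
  unfolding smooth_on_def
proof (intro allI impI conjI ballI)
  fix "is" assume f: "\<forall>is. set is \<subseteq> {..<Suc n} \<longrightarrow> continuous_on (cylinder n S) (pds is f) \<and>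
     (\<forall>i<Suc n. \<forall>x\<in>cylinder n S. (\<lambda>t. pds is f (x(i := t))) differentiable (at (x i)))"
    and "set is \<subseteq> {..<n}"
  then have "set is \<subseteq> {..<Suc n}" by auto
  with f have f: "continuous_on (cylinder n S) (pds is f)"
    "\<forall>i<Suc n. \<forall>x\<in>cylinder n S. (\<lambda>t. pds is f (x(i := t))) differentiable (at (x i))" by blast+
  show "continuous_on S (pds is f)" by (rule continuous_on_subset[OF f(1) subset_cylinder])
  show "(\<lambda>t. pds is f (x(i := t))) differentiable (at (x i))" if "i < n" "x \<in> S" for i x
    using f(2) subset_cylinder that less_SucI by blast
qed

lemma has_real_derivative_product:
  assumes D: "\<And>m t. (D m has_real_derivative D (Suc m) t) (at t)"
    and a: "smooth_on n S a" and p: "p \<in> cylinder n S" and i: "i < Suc n"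
  shows "((\<lambda>t. a ((p(i := t))(n := 0)) * D m ((p(i := t)) n)) has_real_derivative
    (if i = n then a else pd i a) (p(n := 0)) * D (if i = n then Suc m else m) (p n)) (at (p i))"
proof (cases "i = n")
  case True
  then show ?thesis using DERIV_cmult[OF D] by simp
next
  case False
  then have "i < n" using i by simp
  have "((\<lambda>t. a ((p(n := 0))(i := t))) has_real_derivative pd i a (p(n := 0))) (at (p i))"
    using smooth_on_has_pd[OF a \<open>i < n\<close>, of "p(n := 0)"] p False by (simp add: cylinder_def)
  from DERIV_cmult_right[OF this, of "D m (p n)"] show ?thesis
    using False by (simp add: fun_upd_twist[of i n] mult.commute)
qed

lemma smooth_on_product:
  assumes D: "\<And>m t. (D m has_real_derivative D (Suc m) t) (at t)" and a: "smooth_on n S a"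
  shows "smooth_on (Suc n) (cylinder n S) (\<lambda>p. a (p(n := 0)) * D 0 (p n))"
proof (rule smooth_on_coinduct[OF openin_cylinder,
    where X = "{\<lambda>p. a (p(n := 0)) * D m (p n) | a m. smooth_on n S a}"])
  fix h assume "h \<in> {\<lambda>p. a (p(n := 0)) * D m (p n) | a m. smooth_on n S a}"
  then obtain a m where h: "h = (\<lambda>p. a (p(n := 0)) * D m (p n))" and a: "smooth_on n S a" by blast
  have "continuous_on UNIV (D m)" using DERIV_isCont[OF D] by (simp add: continuous_on_eq_continuous_at)
  then have "continuous_on (cylinder n S) (\<lambda>p. D m (p n))"
    by (rule continuous_on_compose2[OF _ continuous_on_subset[OF continuous_on_product_coordinates]]) auto
  moreover have "continuous_on (cylinder n S) (\<lambda>p. a (p(n := 0)))"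
    by (rule continuous_on_compose2[OF smooth_on_imp_continuous_on[OF a] continuous_on_fun_upd])
      (auto simp: cylinder_def)
  ultimately show "continuous_on (cylinder n S) h" unfolding h by (intro continuous_on_mult)
  fix i assume i: "i < Suc n"
  show "\<exists>g\<in>{\<lambda>p. a (p(n := 0)) * D m (p n) | a m. smooth_on n S a}.
    \<forall>p\<in>cylinder n S. ((\<lambda>t. h (p(i := t))) has_real_derivative g p) (at (p i))"
  proof (rule bexI)
    show "\<forall>p\<in>cylinder n S. ((\<lambda>t. h (p(i := t))) has_real_derivative
      (if i = n then a else pd i a) (p(n := 0)) * D (if i = n then Suc m else m) (p n)) (at (p i))"
    proof
      fix p assume "p \<in> cylinder n S"
      from has_real_derivative_product[where D = D and m = m, OF D a this i]
      show "((\<lambda>t. h (p(i := t))) has_real_derivative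
        (if i = n then a else pd i a) (p(n := 0)) * D (if i = n then Suc m else m) (p n)) (at (p i))"
        unfolding h .
    qed
    have "smooth_on n S (if i = n then a else pd i a)" using a i smooth_on_pd[OF a, of i] by auto
    then show "(\<lambda>p. (if i = n then a else pd i a) (p(n := 0)) * D (if i = n then Suc m else m) (p n))
      \<in> {\<lambda>p. a (p(n := 0)) * D m (p n) | a m. smooth_on n S a}"
      by (intro CollectI exI[of _ "if i = n then a else pd i a"] exI[of _ "if i = n then Suc m else m"] conjI refl)
  qed
qed (use a in blast)

text \<open>Derivatives in x act on \<open>a\<close> only and derivatives in y only advance the
  index of \<open>D\<close>. A mixed derivative is thus estimated by one bound for \<open>a\<close>
  and one for the jet.\<close>

lemma pds_product:
  assumes D: "\<And>m t. (D m has_real_derivative D (Suc m) t) (at t)" and a: "smooth_on n S a"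
    and "set is \<subseteq> {..<Suc n}" "p \<in> cylinder n S"
  shows "pds is (\<lambda>p. a (p(n := 0)) * D 0 (p n)) p =
    pds (filter (\<lambda>i. i \<noteq> n) is) a (p(n := 0)) * D (count_list is n) (p n)"
  using assms(3,4)
proof (induction "is" arbitrary: p)
  case (Cons i "is")
  then have i: "i < Suc n" and "is": "set is \<subseteq> {..<Suc n}" by auto
  let ?a = "pds (filter (\<lambda>i. i \<noteq> n) is) a" and ?m = "count_list is n"
  have a': "smooth_on n S ?a" using "is" by (intro smooth_on_pds[OF a]) auto
  have "pds (i # is) (\<lambda>p. a (p(n := 0)) * D 0 (p n)) p = pd i (\<lambda>p. ?a (p(n := 0)) * D ?m (p n)) p"
    unfolding foldr.simps o_apply by (rule pd_cong[OF openin_cylinder Cons.prems(2) i Cons.IH[OF "is"]])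
  also have "\<dots> = (if i = n then ?a else pd i ?a) (p(n := 0)) * D (if i = n then Suc ?m else ?m) (p n)"
    by (rule pd_eqI) (rule has_real_derivative_product[where D = D, OF D a' Cons.prems(2) i])
  finally show ?case
    by (cases "i = n") (simp_all only: filter.simps count_list.simps foldr.simps o_apply
        simp_thms if_True if_False Suc_eq_plus1)
qed simp

text \<open>The product of \<open>a\<close> with a small jet of order \<open>k\<close> works. Total
  order below \<open>k\<close> involves the jet in orders below \<open>k\<close> only, where it is
  tiny for \<bar>y\<bar> \<le> k, as holds on the core. The derivatives of \<open>a\<close> are
  bounded on the compact projection of the core, and the tolerance of the jet is divided by that
  bound.\<close>

lemma borel_approximation_step:
  assumes a: "smooth_on n S a"
  shows "\<exists>h. smooth_on (Suc n) (cylinder n S) h \<and>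
    (\<forall>j<k. \<forall>x\<in>S. pds (replicate j n) h x = 0) \<and> (\<forall>x\<in>S. pds (replicate k n) h x = a x) \<and>
    (\<forall>is. set is \<subseteq> {..<Suc n} \<and> length is < k \<longrightarrow>
      (\<forall>p\<in>compact_core (Suc n) (cylinder n S) k. \<bar>pds is h p\<bar> \<le> (1/2) ^ k))"
proof -
  let ?W = "cylinder n S"
  define K where "K = (\<lambda>p. p(n := 0)) ` compact_core (Suc n) ?W k"
  have "K \<subseteq> S" using compact_core_subset[of "Suc n" ?W k] by (auto simp: K_def cylinder_def)
  have "compact K" unfolding K_def
    by (rule compact_continuous_image[OF continuous_on_fun_upd compact_compact_core])
  define A where "A = {is. set is \<subseteq> {..<n} \<and> length is \<le> k}"
  have "finite A" unfolding A_def by (rule finite_lists_length_le) simp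
  have "\<exists>B. \<forall>x\<in>K. \<bar>pds is a x\<bar> \<le> B" if "is \<in> A" for "is"
    using that \<open>K \<subseteq> S\<close> smooth_on_imp_continuous_on[OF smooth_on_pds[OF a, of "is"]]
    by (intro compact_continuous_bound \<open>compact K\<close>) (auto simp: A_def intro: continuous_on_subset)
  then obtain B where B: "\<And>is x. is \<in> A \<Longrightarrow> x \<in> K \<Longrightarrow> \<bar>pds is a x\<bar> \<le> B is" by metis
  \<comment> \<open>The summand 1 keeps \<open>C\<close> positive, so that it may be divided
    by.\<close>
  define C where "C = 1 + (\<Sum>is\<in>A. \<bar>B is\<bar>)"
  have C: "\<bar>pds is a x\<bar> \<le> C" if "is \<in> A" "x \<in> K" for "is" x
    using B[OF that] member_le_sum[of "is" A "\<lambda>is. \<bar>B is\<bar>"] that \<open>finite A\<close> by (simp add: C_def)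
  have "C > 0" unfolding C_def by (intro add_pos_nonneg sum_nonneg) auto
  have "(1/2) ^ k / C > 0" using \<open>C > 0\<close> by simp
  from exists_small_jet[of "real k" "(1/2) ^ k / C" k, OF of_nat_0_le_iff this]
  obtain D :: "nat \<Rightarrow> real \<Rightarrow> real" where D: "\<And>m t. (D m has_real_derivative D (Suc m) t) (at t)"
    "\<And>m. m < k \<Longrightarrow> D m 0 = 0" "D k 0 = 1"
    "\<And>m t. m < k \<Longrightarrow> \<bar>t\<bar> \<le> real k \<Longrightarrow> \<bar>D m t\<bar> \<le> (1/2) ^ k / C"
    by blast
  define h where "h = (\<lambda>p. a (p(n := 0)) * D 0 (p n))"
  have at_S: "pds (replicate j n) h x = a x * D j 0" if "x \<in> S" for j x
  proof -
    have "x n = 0" using openin_Euclidean_spaceD[OF S that] by simp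
    then have "x(n := 0) = x" by auto
    moreover have "count_list (replicate j n) n = j" by (induction j) auto
    moreover have "set (replicate j n) \<subseteq> {..<Suc n}" by auto
    moreover have "x \<in> ?W" using that subset_cylinder by blast
    ultimately show ?thesis
      using pds_product[of D a "replicate j n" x] D(1) a \<open>x n = 0\<close>
      by (simp add: h_def)
  qed
  have "\<bar>pds is h p\<bar> \<le> (1/2) ^ k"
    if "is": "set is \<subseteq> {..<Suc n}" "length is < k" and p: "p \<in> compact_core (Suc n) ?W k" for "is" p
  proof -
    let ?is' = "filter (\<lambda>i. i \<noteq> n) is"
    have "?is' \<in> A" using "is" length_filter_le[of "\<lambda>i. i \<noteq> n" "is"] by (auto simp: A_def intro: order.trans[OF length_filter_le])
    then have 1: "\<bar>pds ?is' a (p(n := 0))\<bar> \<le> C" using p by (intro C) (auto simp: K_def)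
    have "count_list is n < k" using "is"(2) count_le_length[of "is" n] by simp
    moreover have "\<bar>p n\<bar> \<le> real k" using p by (simp add: compact_core_def)
    ultimately have 2: "\<bar>D (count_list is n) (p n)\<bar> \<le> (1/2) ^ k / C" using D(4) by blast
    have "p \<in> ?W" using p compact_core_subset by blast
    then have "\<bar>pds is h p\<bar> = \<bar>pds ?is' a (p(n := 0))\<bar> * \<bar>D (count_list is n) (p n)\<bar>"
      using pds_product[of D a "is" p] D(1) a "is"
      by (simp add: h_def abs_mult)
    also have "\<dots> \<le> C * ((1/2) ^ k / C)" using 1 2 \<open>C > 0\<close> by (intro mult_mono) auto
    also have "\<dots> = (1/2) ^ k" using \<open>C > 0\<close> by simp
    finally show ?thesis .
  qed
  moreover have "smooth_on (Suc n) ?W h" unfolding h_def by (rule smooth_on_product[where D = D, OF D(1) a])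
  ultimately show ?thesis using D(2,3) at_S by (intro exI[of _ h]) auto
qed

text \<open>Step \<open>k\<close> adds a correction that repairs the y-derivative of order
  \<open>k\<close> on the zero section, leaves the lower orders alone, and is at most
  \<open>(1/2) ^ k\<close> on the \<open>k\<close>-th core together with its derivatives of order
  below \<open>k\<close>. The corrections therefore sum to a smooth function, and its derivatives in
  y at y = 0 are computed by telescoping.\<close>

lemma borel_one_variable:
  assumes c: "\<And>k. smooth_on n S (c k)"
  shows "\<exists>G. smooth_on (Suc n) (cylinder n S) G \<and> (\<forall>k. \<forall>x\<in>S. pds (replicate k n) G x = c k x)"
proof -
  let ?W = "cylinder n S"
  \<comment> \<open>The clause for \<open>k = 0\<close> makes the sequence start at the zero
    function, so that the telescoping sum has no initial term.\<close>
  define P where "P = (\<lambda>k g. smooth_on (Suc n) ?W g \<and>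
    (\<forall>j<k. \<forall>x\<in>S. pds (replicate j n) g x = c j x) \<and> (k = 0 \<longrightarrow> g = (\<lambda>x. 0)))"
  define Q where "Q = (\<lambda>k g g'. \<forall>is. set is \<subseteq> {..<Suc n} \<and> length is < k \<longrightarrow>
      (\<forall>p\<in>compact_core (Suc n) ?W k. \<bar>pds is (\<lambda>p. g' p - g p) p\<bar> \<le> (1/2) ^ k))"
  have "\<exists>g. \<forall>k. P k (g k) \<and> Q k (g k) (g (Suc k))"
  proof (rule dependent_nat_choice)
    show "\<exists>g. P 0 g" unfolding P_def using smooth_on_const[OF openin_cylinder] by auto
    fix g k assume g: "P k g"
    have rep: "set (replicate j n) \<subseteq> {..<Suc n}" for j by auto
    \<comment> \<open>The defect in order \<open>k\<close> includes whatever the earlier corrections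
      contribute there, since their higher derivatives are not controlled.\<close>
    have "smooth_on n S (\<lambda>x. c k x - pds (replicate k n) g x)"
      using g smooth_on_cylinder_restrict[OF smooth_on_pds[OF _ rep]]
      by (intro smooth_on_diff[OF S c]) (auto simp: P_def)
    from borel_approximation_step[OF this, of k] obtain h where h: "smooth_on (Suc n) ?W h"
      "\<And>j x. j < k \<Longrightarrow> x \<in> S \<Longrightarrow> pds (replicate j n) h x = 0"
      "\<And>x. x \<in> S \<Longrightarrow> pds (replicate k n) h x = c k x - pds (replicate k n) g x"
      "\<And>is p. set is \<subseteq> {..<Suc n} \<Longrightarrow> length is < k \<Longrightarrow> p \<in> compact_core (Suc n) ?W k \<Longrightarrow>
        \<bar>pds is h p\<bar> \<le> (1/2) ^ k" by blast
    have g': "smooth_on (Suc n) ?W g" using g by (simp add: P_def)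
    have "pds (replicate j n) (\<lambda>p. g p + h p) x = c j x" if "j < Suc k" "x \<in> S" for j x
    proof -
      have "pds (replicate j n) (\<lambda>p. g p + h p) x = pds (replicate j n) g x + pds (replicate j n) h x"
        using that(2) subset_cylinder by (intro pds_add[OF openin_cylinder g' h(1) rep]) auto
      then show ?thesis using that h(2,3) g by (cases "j = k") (auto simp: P_def)
    qed
    then have "P (Suc k) (\<lambda>p. g p + h p)"
      unfolding P_def using smooth_on_add[OF openin_cylinder g' h(1)] by auto
    moreover have "Q k g (\<lambda>p. g p + h p)" unfolding Q_def using h(4) by simp
    ultimately show "\<exists>g'. P (Suc k) g' \<and> Q k g g'" by blast
  qed
  then obtain g where P: "\<And>k. P k (g k)" and Q: "\<And>k. Q k (g k) (g (Suc k))" by blast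
  have g: "smooth_on (Suc n) ?W (g k)" for k using P by (simp add: P_def)
  define H where "H = (\<lambda>k p. g (Suc k) p - g k p)"
  have H: "smooth_on (Suc n) ?W (H k)" for k
    unfolding H_def by (rule smooth_on_diff[OF openin_cylinder g g])
  have bound: "\<exists>e>0. \<exists>k0. \<forall>k\<ge>k0. \<forall>y\<in>?W. (\<forall>i<Suc n. \<bar>y i - x i\<bar> < e) \<longrightarrow>
      (\<forall>is. set is \<subseteq> {..<Suc n} \<longrightarrow> length is < k \<longrightarrow> \<bar>pds is (H k) y\<bar> \<le> (1/2) ^ k)" if "x \<in> ?W" for x
    using compact_core_nhd[OF openin_cylinder that] Q unfolding Q_def H_def by meson
  define G where "G = (\<lambda>x. \<Sum>k. H k x)"
  have "pds (replicate j n) G x = c j x" if x: "x \<in> S" for j x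
  proof -
    have rep: "set (replicate j n) \<subseteq> {..<Suc n}" by auto
    have xW: "x \<in> ?W" using x subset_cylinder by blast
    have "pds (replicate j n) G x = (\<Sum>k. pds (replicate j n) (H k) x)"
      unfolding G_def by (rule smooth_on_suminf(2)[OF openin_cylinder H bound rep xW])
    also have "\<dots> = (\<Sum>k. pds (replicate j n) (g (Suc k)) x - pds (replicate j n) (g k) x)"
      unfolding H_def by (intro arg_cong[of _ _ suminf] ext pds_diff[OF openin_cylinder g g rep xW])
    also have "\<dots> = c j x - pds (replicate j n) (g 0) x"
    proof (rule sums_unique[symmetric], rule telescope_sums)
      have "\<forall>\<^sub>F k in sequentially. pds (replicate j n) (g k) x = c j x"
        using eventually_gt_at_top[of j] by eventually_elim (use P x in \<open>auto simp: P_def\<close>)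
      then show "(\<lambda>k. pds (replicate j n) (g k) x) \<longlonglongrightarrow> c j x" by (rule tendsto_eventually)
    qed
    also have "pds (replicate j n) (g 0) x = 0"
    proof -
      have "g 0 = (\<lambda>x. 0)" using P[of 0] by (simp add: P_def)
      then show ?thesis by (simp only: pds_zero)
    qed
    finally show ?thesis by simp
  qed
  moreover have "smooth_on (Suc n) ?W G"
    unfolding G_def by (rule smooth_on_suminf(1)[OF openin_cylinder H bound])
  ultimately show ?thesis by blast
qed

end

lemma sorted_list_of_multiset_unique:
  "sorted xs \<Longrightarrow> mset xs = M \<Longrightarrow> sorted_list_of_multiset M = xs"
  by (auto simp: sorted_sort_id)

text \<open>Induction on the number of variables: the derivatives in the last variable are
  prescribed to be functions \<open>G k\<close> that solve the problem in the preceding variables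
  for the family shifted by \<open>k\<close> copies of the last index. \<open>W\<close> is chosen
  before \<open>c\<close>, because the coefficients of different monomials have to live on one
  common base.\<close>

lemma borel_several_variables:
  assumes S: "openin (Euclidean_space n) S"
  shows "\<exists>W. openin (Euclidean_space (n + r)) W \<and> S \<subseteq> W \<and>
    (\<forall>c. (\<forall>L. smooth_on n S (c L)) \<longrightarrow> (\<exists>G. smooth_on (n + r) W G \<and>
      (\<forall>L. set_mset L \<subseteq> {n..<n + r} \<longrightarrow> (\<forall>x\<in>S. pds (sorted_list_of_multiset L) G x = c L x))))"
proof (induction r)
  case 0
  show ?case by (rule exI[of _ S]) (use S in auto)
next
  case (Suc r)
  then obtain W where W: "openin (Euclidean_space (n + r)) W" "S \<subseteq> W"
    and IH: "\<And>c. (\<And>L. smooth_on n S (c L)) \<Longrightarrow> \<exists>G. smooth_on (n + r) W G \<and>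
      (\<forall>L. set_mset L \<subseteq> {n..<n + r} \<longrightarrow> (\<forall>x\<in>S. pds (sorted_list_of_multiset L) G x = c L x))"
    by blast
  have "\<exists>G. smooth_on (n + Suc r) (cylinder (n + r) W) G \<and>
      (\<forall>L. set_mset L \<subseteq> {n..<n + Suc r} \<longrightarrow> (\<forall>x\<in>S. pds (sorted_list_of_multiset L) G x = c L x))"
    if c: "\<And>L. smooth_on n S (c L)" for c
  proof -
    have "\<forall>k. \<exists>G. smooth_on (n + r) W G \<and> (\<forall>L. set_mset L \<subseteq> {n..<n + r} \<longrightarrow>
        (\<forall>x\<in>S. pds (sorted_list_of_multiset L) G x = c (L + replicate_mset k (n + r)) x))"
      using IH[of "\<lambda>L. c (L + replicate_mset _ (n + r))"] c by blast
    then obtain G where G: "\<And>k. smooth_on (n + r) W (G k)"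
      "\<And>k L x. set_mset L \<subseteq> {n..<n + r} \<Longrightarrow> x \<in> S \<Longrightarrow>
        pds (sorted_list_of_multiset L) (G k) x = c (L + replicate_mset k (n + r)) x" by metis
    obtain F where F: "smooth_on (Suc (n + r)) (cylinder (n + r) W) F"
      "\<And>k x. x \<in> W \<Longrightarrow> pds (replicate k (n + r)) F x = G k x"
      using borel_one_variable[of "n + r" W G, OF W(1) G(1)] by blast
    have "pds (sorted_list_of_multiset L) F x = c L x"
      if L: "set_mset L \<subseteq> {n..<n + Suc r}" and x: "x \<in> S" for L x
    proof -
      define k where "k = count L (n + r)"
      define L' where "L' = filter_mset (\<lambda>i. i \<noteq> n + r) L"
      have L': "set_mset L' \<subseteq> {n..<n + r}" using L by (auto simp: L'_def)
      have L_eq: "L = L' + replicate_mset k (n + r)"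
        by (rule multiset_eqI) (auto simp: L'_def k_def)
      \<comment> \<open>The last variable has the greatest index, so it ends the sorted list, where
        \<open>foldr\<close> applies it innermost. The order of differentiation then agrees with the
        construction of \<open>F\<close>.\<close>
      have "sorted_list_of_multiset L = sorted_list_of_multiset L' @ replicate k (n + r)"
        by (rule sorted_list_of_multiset_unique)
          (use L' in \<open>auto simp: L_eq sorted_append set_sorted_list_of_multiset subset_iff less_imp_le\<close>)
      then have "pds (sorted_list_of_multiset L) F x =
          pds (sorted_list_of_multiset L') (pds (replicate k (n + r)) F) x" by simp
      also have "\<dots> = pds (sorted_list_of_multiset L') (G k) x"
        using L' F(2) W(2) x by (intro pds_cong[OF W(1)]) auto
      also have "\<dots> = c L x" using G(2)[OF L' x] L_eq by simp
      finally show ?thesis .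
    qed
    then show ?thesis using F(1) by auto
  qed
  moreover have "openin (Euclidean_space (n + Suc r)) (cylinder (n + r) W)"
    using openin_cylinder[OF W(1)] by simp
  moreover have "S \<subseteq> cylinder (n + r) W" using W(2) subset_cylinder[OF W(1)] by blast
  ultimately show ?case by (intro exI[of _ "cylinder (n + r) W"]) blast
qed

section \<open>Decomposition of monomials of a given degree\<close>

lemma sum_mset_eq_sum_count:
  fixes N :: nat
  assumes "set_mset I \<subseteq> {..<N}"
  shows "(\<Sum>a\<in>#I. f a) = (\<Sum>a<N. int (count I a) * f a)"
  using assms
proof (induction I)
  case (add a I)
  have "(\<Sum>b<N. int (count (add_mset a I) b) * f b) =
      (\<Sum>b<N. int (count I b) * f b + (if b = a then f b else 0))"
    by (intro sum.cong) (auto simp: algebra_simps)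
  also have "\<dots> = (\<Sum>b<N. int (count I b) * f b) + f a"
    using add.prems by (simp add: sum.distrib sum.delta)
  finally show ?case using add by simp
qed simp

text \<open>This rests on \<open>\<bar>d\<bar> = 2 * max (s * d) 0 - s * d\<close>.\<close>
lemma size_bounded_if_one_sign_bounded:
  fixes ds :: "int list"
  assumes I: "set_mset I \<subseteq> {..<length ds}" and nz: "\<forall>d\<in>set ds. d \<noteq> 0"
    and D: "\<And>a. a < length ds \<Longrightarrow> \<bar>ds ! a\<bar> \<le> D" and s: "s = 1 \<or> s = - 1"
    and small: "\<And>a. a < length ds \<Longrightarrow> s * ds ! a > 0 \<Longrightarrow> int (count I a) \<le> D"
  shows "int (size I) \<le> 2 * int (length ds) * (D * D) + \<bar>\<Sum>a\<in>#I. ds ! a\<bar>"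
proof -
  let ?N = "length ds"
  let ?c = "\<lambda>a. int (count I a)"
  have "int (size I) = (\<Sum>a<?N. ?c a)"
    using sum_mset_eq_sum_count[OF I, of "\<lambda>_. 1"] by simp
  also have "\<dots> \<le> (\<Sum>a<?N. 2 * (D * D) - ?c a * (s * ds ! a))"
  proof (rule sum_mono)
    fix a assume "a \<in> {..<?N}"
    then have a: "a < ?N" by simp
    then have "ds ! a \<noteq> 0" using nz by auto
    then have d: "s * ds ! a \<noteq> 0" using s by auto
    have D': "\<bar>s * ds ! a\<bar> \<le> D" using D[OF a] s by (auto simp: abs_mult)
    show "?c a \<le> 2 * (D * D) - ?c a * (s * ds ! a)"
    proof (cases "s * ds ! a > 0")
      case True
      have "?c a * (s * ds ! a) \<le> D * D"
        using small[OF a True] D' True by (intro mult_mono) auto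
      moreover have "?c a * 1 \<le> D * D"
        using small[OF a True] D' True by (intro mult_mono) auto
      ultimately show ?thesis by simp
    next
      case False
      with d have "1 \<le> - (s * ds ! a)" by linarith
      then have "?c a * 1 \<le> ?c a * (- (s * ds ! a))" by (intro mult_left_mono) auto
      moreover have "0 \<le> D * D" by simp
      ultimately show ?thesis by linarith
    qed
  qed
  also have "\<dots> = 2 * int ?N * (D * D) - s * (\<Sum>a<?N. ?c a * ds ! a)"
    by (simp add: sum_subtractf sum_distrib_left mult_ac)
  also have "\<dots> = 2 * int ?N * (D * D) - s * (\<Sum>a\<in>#I. ds ! a)"
    using sum_mset_eq_sum_count[OF I, of "\<lambda>a. ds ! a"] by simp
  also have "\<dots> \<le> 2 * int ?N * (D * D) + \<bar>\<Sum>a\<in>#I. ds ! a\<bar>" using s by auto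
  finally show ?thesis .
qed

text \<open>As long as two variables with degrees of opposite sign both have exponent at least
  \<open>D\<close>, a generator can be split off, which lowers the size and keeps the degree.
  Otherwise all exponents belonging to one sign are at most \<open>D\<close>, and the degree bounds
  the remaining ones; finitely many cofactors are left.\<close>

lemma monomials_finitely_generated:
  fixes ds :: "int list"
  assumes nz: "\<forall>d\<in>set ds. d \<noteq> 0"
  obtains ms :: "nat multiset list" where
    "\<And>m. m \<in> set ms \<Longrightarrow> m \<noteq> {#} \<and> set_mset m \<subseteq> {..<length ds} \<and> (\<Sum>a\<in>#m. ds ! a) = 0"
    "\<And>d. \<exists>W. finite W \<and> (\<forall>I. set_mset I \<subseteq> {..<length ds} \<and> (\<Sum>a\<in>#I. ds ! a) = d \<longrightarrow>
      (\<exists>w\<in>W. \<exists>L. set_mset L \<subseteq> {..<length ms} \<and> I = w + (\<Sum>i\<in>#L. ms ! i)))"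
proof -
  let ?N = "length ds"
  define m where "m = (\<lambda>(a, b). replicate_mset (nat (- ds ! b)) a + replicate_mset (nat (ds ! a)) b)"
  define P where "P = {(a, b). a < ?N \<and> b < ?N \<and> ds ! a > 0 \<and> ds ! b < 0}"
  have "finite P" by (rule finite_subset[of _ "{..<?N} \<times> {..<?N}"]) (auto simp: P_def)
  then obtain ps where ps: "set ps = P" using finite_list by blast
  define ms where "ms = map m ps"
  have gen: "x \<noteq> {#} \<and> set_mset x \<subseteq> {..<?N} \<and> (\<Sum>a\<in>#x. ds ! a) = 0" if x: "x \<in> set ms" for x
  proof -
    obtain a b where ab: "x = m (a, b)" "a < ?N" "b < ?N" "ds ! a > 0" "ds ! b < 0"
      using x ps by (auto simp: ms_def P_def)
    have "(\<Sum>i\<in>#x. ds ! i) = 0" using ab by (simp add: m_def algebra_simps)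
    moreover have "x \<noteq> {#}" using ab by (simp add: m_def)
    moreover have "set_mset x \<subseteq> {..<?N}" using ab by (auto simp: m_def split: if_splits)
    ultimately show ?thesis by blast
  qed
  \<comment> \<open>A common bound for the absolute degrees, which are the exponents in the
    generators: exponents of at least \<open>D\<close> leave room for a generator.\<close>
  define D where "D = (\<Sum>a<?N. \<bar>ds ! a\<bar>)"
  have D: "\<bar>ds ! a\<bar> \<le> D" if "a < ?N" for a
    unfolding D_def using that by (intro member_le_sum) auto
  \<comment> \<open>The size bound of \<open>size_bounded_if_one_sign_bounded\<close>. It depends on
    the degree only and so does not change when generators are removed.\<close>
  define B where "B = (\<lambda>d. nat (2 * int ?N * (D * D) + \<bar>d\<bar>))"
  have main: "\<exists>w\<in>{w. set_mset w \<subseteq> {..<?N} \<and> size w \<le> B (\<Sum>a\<in>#I. ds ! a)}.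
      \<exists>L. set_mset L \<subseteq> {..<length ms} \<and> I = w + (\<Sum>i\<in>#L. ms ! i)"
    if "set_mset I \<subseteq> {..<?N}" for I
    using that
  proof (induction "size I" arbitrary: I rule: less_induct)
    case less
    show ?case
    proof (cases "\<exists>(a, b)\<in>P. D \<le> int (count I a) \<and> D \<le> int (count I b)")
      case True
      then obtain a b where ab: "(a, b) \<in> P" "D \<le> int (count I a)" "D \<le> int (count I b)" by auto
      then have ab': "a < ?N" "b < ?N" "ds ! a > 0" "ds ! b < 0" by (auto simp: P_def)
      then have "a \<noteq> b" by auto
      have "m (a, b) \<subseteq># I"
      proof (rule mset_subset_eqI)
        fix i show "count (m (a, b)) i \<le> count I i"
          using ab ab' D[of a] D[of b] \<open>a \<noteq> b\<close> by (auto simp: m_def)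
      qed
      then obtain I' where I': "I = m (a, b) + I'" by (metis subset_mset.add_diff_inverse)
      obtain j where j: "j < length ms" "ms ! j = m (a, b)"
        using ab(1) ps unfolding ms_def by (metis in_set_conv_nth length_map nth_map)
      then have mem: "m (a, b) \<in> set ms" by (metis nth_mem)
      have "size I' < size I" using gen[OF mem] I' by (simp add: nonempty_has_size)
      moreover have "set_mset I' \<subseteq> {..<?N}" using less.prems I' by auto
      ultimately obtain w L where
        wL: "set_mset w \<subseteq> {..<?N}" "size w \<le> B (\<Sum>a\<in>#I'. ds ! a)" "set_mset L \<subseteq> {..<length ms}"
          "I' = w + (\<Sum>i\<in>#L. ms ! i)"
        using less.hyps by blast
      have "(\<Sum>a\<in>#I. ds ! a) = (\<Sum>a\<in>#I'. ds ! a)" using gen[OF mem] I' by simp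
      moreover have "I = w + (\<Sum>i\<in>#add_mset j L. ms ! i)" using I' wL(4) j(2) by simp
      moreover have "set_mset (add_mset j L) \<subseteq> {..<length ms}" using wL(3) j(1) by simp
      ultimately show ?thesis using wL(1,2) by (metis (mono_tags, lifting) mem_Collect_eq)
    next
      case False
      have "\<exists>s. (s = 1 \<or> s = - 1) \<and> (\<forall>a<?N. s * ds ! a > 0 \<longrightarrow> int (count I a) \<le> D)"
      proof (cases "\<forall>a<?N. ds ! a > 0 \<longrightarrow> int (count I a) \<le> D")
        case True
        then show ?thesis by (intro exI[of _ 1]) auto
      next
        case False': False
        then obtain a where a: "a < ?N" "ds ! a > 0" "D \<le> int (count I a)" by force
        \<comment> \<open>The exponent of \<open>a\<close> is large, so \<open>b\<close> cannot also
          have a large one: no generator splits off. Hence the negative degrees are the bounded side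
          and \<open>s\<close> is -1.\<close>
        have "int (count I b) \<le> D" if "b < ?N" "ds ! b < 0" for b
          using False a that by (force simp: P_def)
        then show ?thesis by (intro exI[of _ "- 1"]) auto
      qed
      then obtain s where s: "s = 1 \<or> s = - 1"
        "\<And>a. a < ?N \<Longrightarrow> s * ds ! a > 0 \<Longrightarrow> int (count I a) \<le> D" by blast
      have "size I \<le> B (\<Sum>a\<in>#I. ds ! a)"
        using size_bounded_if_one_sign_bounded[OF less.prems nz D s] by (simp add: B_def)
      then show ?thesis using less.prems by (intro bexI[of _ I] exI[of _ "{#}"]) auto
    qed
  qed
  show thesis
  proof (rule that[of ms, OF gen])
    fix d
    show "\<exists>W. finite W \<and> (\<forall>I. set_mset I \<subseteq> {..<?N} \<and> (\<Sum>a\<in>#I. ds ! a) = d \<longrightarrow>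
      (\<exists>w\<in>W. \<exists>L. set_mset L \<subseteq> {..<length ms} \<and> I = w + (\<Sum>i\<in>#L. ms ! i)))"
      using main by (intro exI[of _ "{w. set_mset w \<subseteq> {..<?N} \<and> size w \<le> B d}"] conjI
          finite_bounded_multisets) auto
  qed
qed

section \<open>Graded functions as pull-backs of polynomials\<close>

definition monomial_at :: "(nat \<Rightarrow> real) \<Rightarrow> series \<Rightarrow> monomial \<Rightarrow> bool" where
  "monomial_at x f M \<longleftrightarrow> (\<forall>M'. f M' x = (if M' = M then 1 else 0))"

lemma sum_single:
  fixes F :: "'a \<Rightarrow> 'b::comm_monoid_add"
  assumes "finite S" "\<And>i. i \<in> S \<Longrightarrow> i \<noteq> a \<Longrightarrow> F i = 0"
  shows "sum F S = (if a \<in> S then F a else 0)"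
proof -
  have "sum F S = (\<Sum>i\<in>S. if i = a then F i else 0)" using assms(2) by (intro sum.cong) auto
  then show ?thesis using assms(1) by simp
qed

lemma finite_submultisets: "finite {I'. I' \<subseteq># I}"
  by (rule finite_subset[OF _ finite_bounded_multisets[of "set_mset I" "size I"]])
    (auto dest: mset_subset_eqD size_mset_mono)

text \<open>A single splitting contributes to the convolution. All indices in \<open>J\<close>
  precede those in \<open>J'\<close>, so no odd variables are interchanged and the coefficient is 1
  without a sign.\<close>

lemma monomial_at_ser_mult:
  assumes f: "monomial_at x f (I, J)" and g: "monomial_at x g (I', J')"
    and fin: "finite J" "finite J'" and less: "\<And>a b. a \<in> J \<Longrightarrow> b \<in> J' \<Longrightarrow> a < b"
  shows "monomial_at x (ser_mult f g) (I + I', J \<union> J')"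
  unfolding monomial_at_def
proof
  fix M :: monomial
  obtain A B where M: "M = (A, B)" by force
  have inv: "{(a, b). a \<in> J \<and> b \<in> J' \<and> b < a} = {}" using less by force
  have sign: "koszul_sign J J' = 1" unfolding koszul_sign_def inv by simp
  have disj: "J \<inter> J' = {}" using less by blast
  show "ser_mult f g M x = (if M = (I + I', J \<union> J') then 1 else 0)"
  proof (cases "finite B")
    case False
    then show ?thesis using fin by (auto simp: M ser_mult_def)
  next
    case True
    let ?t = "\<lambda>I1 J1. koszul_sign J1 (B - J1) * f (I1, J1) x * g (A - I1, B - J1) x"
    have inner: "(\<Sum>J1\<in>Pow B. ?t I1 J1) = (if J \<in> Pow B then ?t I1 J else 0)" for I1
      using True f by (intro sum_single) (auto simp: monomial_at_def)
    have "ser_mult f g M x = (\<Sum>I1\<in>{I'. I' \<subseteq># A}. if J \<in> Pow B then ?t I1 J else 0)"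
      by (simp add: M ser_mult_def inner)
    also have "\<dots> = (if I \<in> {I'. I' \<subseteq># A} then (if J \<in> Pow B then ?t I J else 0) else 0)"
      using f by (intro sum_single finite_submultisets) (auto simp: monomial_at_def)
    also have "\<dots> = (if I \<subseteq># A \<and> J \<subseteq> B \<and> A - I = I' \<and> B - J = J' then 1 else 0)"
      using f g sign by (auto simp: monomial_at_def)
    also have "(I \<subseteq># A \<and> J \<subseteq> B \<and> A - I = I' \<and> B - J = J') \<longleftrightarrow> M = (I + I', J \<union> J')"
      using disj by (auto simp: M)
    finally show ?thesis .
  qed
qed

lemma monomial_at_ser_one: "monomial_at x ser_one ({#}, {})"
  by (simp add: monomial_at_def ser_one_def)

lemma monomial_at_ser_prod_odd:
  assumes "\<And>j. j \<in> set js \<Longrightarrow> monomial_at x (F j) ({#}, {j})" "sorted_wrt (<) js"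
  shows "monomial_at x (ser_prod (map F js)) ({#}, set js)"
  using assms
proof (induction js)
  case (Cons j js)
  then have "monomial_at x (ser_mult (F j) (ser_prod (map F js))) ({#} + {#}, {j} \<union> set js)"
    by (intro monomial_at_ser_mult) auto
  then show ?case by (simp add: ser_prod_def)
qed (simp add: ser_prod_def monomial_at_ser_one)

lemma monomial_at_ser_prod_even:
  assumes "\<And>i. i \<in> set is \<Longrightarrow> monomial_at x (F i) (m i, {})"
    and "monomial_at x (ser_prod gs) (I, J)" "finite J"
  shows "monomial_at x (ser_prod (map F is @ gs)) ((\<Sum>i\<leftarrow>is. m i) + I, J)"
  using assms(1)
proof (induction "is")
  case Nil
  then show ?case using assms(2) by simp
next
  case (Cons i "is")
  then have "monomial_at x (ser_mult (F i) (ser_prod (map F is @ gs)))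
      (m i + ((\<Sum>i\<leftarrow>is. m i) + I), {} \<union> J)"
    using assms(3) by (intro monomial_at_ser_mult) auto
  then show ?case by (simp add: ser_prod_def add.assoc)
qed

lemma ser_prod_eq_zero:
  assumes "f \<in> set fs" "\<And>M. f M x = 0"
  shows "ser_prod fs M x = 0"
  using assms(1)
proof (induction fs arbitrary: M)
  case (Cons g fs)
  show ?case
  proof (cases "g = f")
    case True
    then show ?thesis using assms(2) by (cases M) (simp add: ser_prod_def ser_mult_def)
  next
    case False
    then have "ser_prod fs M x = 0" for M using Cons by auto
    then show ?thesis by (cases M) (simp add: ser_prod_def ser_mult_def)
  qed
qed simp

definition monomial_series ::
  "(nat \<Rightarrow> real) set \<Rightarrow> monomial \<Rightarrow> ((nat \<Rightarrow> real) \<Rightarrow> real) \<Rightarrow> series" where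
  "monomial_series S M u = (\<lambda>M' x. if M' = M \<and> x \<in> S then u x else 0)"

lemma monomial_series_eq:
  "monomial_series S M u M' = (if M' = M then (\<lambda>x. if x \<in> S then u x else 0) else (\<lambda>x. 0))"
  by (auto simp: monomial_series_def)

lemma smooth_funs_restrict:
  assumes "openin (Euclidean_space n) S" "smooth_on n S u"
  shows "(\<lambda>x. if x \<in> S then u x else 0) \<in> smooth_funs n S"
  using smooth_on_cong[OF assms(1) _ assms(2), of "\<lambda>x. if x \<in> S then u x else 0"]
  by (simp add: smooth_funs_iff)

lemma monomial_series_graded:
  assumes U: "graded_chart U" and u: "smooth_on (base_dim U) (base U) u" and M: "M \<in> monomials U"
  shows "monomial_series (base U) M u \<in> graded_funs_hom U (mdeg U M)"
    and "monomial_series (base U) M u \<in> polynomial_funs U"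
proof -
  have "monomial_series (base U) M u M' \<in> smooth_funs (base_dim U) (base U)" for M'
    using smooth_funs_restrict[OF graded_chart_openin[OF U] u] smooth_funs_zero[OF graded_chart_openin[OF U]]
    by (simp add: monomial_series_eq)
  moreover have "finite {M'. monomial_series (base U) M u M' \<noteq> (\<lambda>x. 0)}"
    by (rule finite_subset[of _ "{M}"]) (auto simp: monomial_series_eq)
  moreover have "M' = M" if "monomial_series (base U) M u M' \<noteq> (\<lambda>x. 0)" for M'
    using that by (auto simp: monomial_series_eq split: if_splits)
  ultimately show "monomial_series (base U) M u \<in> graded_funs_hom U (mdeg U M)"
    "monomial_series (base U) M u \<in> polynomial_funs U"
    using M by (auto simp: graded_funs_hom_def polynomial_funs_def)
qed

lemma monomial_at_monomial_series:
  "x \<in> S \<Longrightarrow> monomial_at x (monomial_series S M (\<lambda>_. 1)) M"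
  by (simp add: monomial_at_def monomial_series_def)

lemma multi_fact_nonzero: "multi_fact L \<noteq> 0"
  by (simp add: multi_fact_def)

text \<open>The target has the same V and a base \<open>W\<close> in R^(n+r). The morphism is the
  identity on all coordinates of \<open>U\<close> and sends the additional y's to the generators.
  The pull-back of a function u(x, y) times a monomial \<open>K\<close> is then the sum over
  \<open>L\<close> of the Taylor coefficients of u at y = 0, times the generators to the power
  \<open>L\<close>, times \<open>K\<close>. It remains to distribute the coefficients of
  \<open>f\<close> over the pairs \<open>(K, L)\<close>.\<close>

lemma graded_fun_is_pullback:
  assumes U: "graded_chart U" and f: "f \<in> graded_funs U"
  obtains U' \<phi> g where "graded_chart U'" "class_morphism polynomial_funs U U' \<phi>"
    "g \<in> polynomial_funs U'" "pullback U U' \<phi> g = f"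
proof -
  define n where "n = base_dim U"
  define S where "S = base U"
  define ds where "ds = even_degs U"
  define F where "F = {M. f M \<noteq> (\<lambda>x. 0)}"
  have S: "openin (Euclidean_space n) S" using graded_chart_openin[OF U] by (simp add: n_def S_def)
  have f_smooth: "\<And>M. smooth_on n S (f M)" "\<And>M x. x \<notin> S \<Longrightarrow> f M x = 0"
    and F_sub: "F \<subseteq> monomials U" and fin: "finite (mdeg U ` F)"
    using f by (auto simp: graded_funs_iff[OF U] smooth_funs_iff n_def S_def F_def)
  have F_mon: "set_mset (fst M) \<subseteq> {..<length ds}" "snd M \<subseteq> {..<length (odd_degs U)}" if "M \<in> F" for M
    using subsetD[OF F_sub that] by (auto simp: monomials_def ds_def)
  have nz: "\<forall>d\<in>set ds. d \<noteq> 0" using U by (auto simp: graded_chart_def ds_def)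
  obtain ms :: "nat multiset list" where
    ms: "\<And>m. m \<in> set ms \<Longrightarrow> m \<noteq> {#} \<and> set_mset m \<subseteq> {..<length ds} \<and> (\<Sum>a\<in>#m. ds ! a) = 0"
    and dec: "\<And>d. \<exists>W. finite W \<and> (\<forall>I. set_mset I \<subseteq> {..<length ds} \<and> (\<Sum>a\<in>#I. ds ! a) = d \<longrightarrow>
      (\<exists>w\<in>W. \<exists>L. set_mset L \<subseteq> {..<length ms} \<and> I = w + (\<Sum>i\<in>#L. ms ! i)))"
    by (rule monomials_finitely_generated[OF nz]) (rule that; assumption)
  define r where "r = length ms"
  from dec obtain V where V: "\<And>d. finite (V d)"
    "\<And>I. set_mset I \<subseteq> {..<length ds} \<Longrightarrow>
      \<exists>w\<in>V (\<Sum>a\<in>#I. ds ! a). \<exists>L. set_mset L \<subseteq> {..<r} \<and> I = w + (\<Sum>i\<in>#L. ms ! i)"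
    unfolding r_def by metis
  have "\<exists>w L. w \<in> V (\<Sum>a\<in>#fst M. ds ! a) \<and> set_mset L \<subseteq> {..<r} \<and> fst M = w + (\<Sum>i\<in>#L. ms ! i)"
    if "M \<in> F" for M
    using V(2)[OF F_mon(1)[OF that]] by blast
  then obtain w L where wL: "\<And>M. M \<in> F \<Longrightarrow> w M \<in> V (\<Sum>a\<in>#fst M. ds ! a)"
    "\<And>M. M \<in> F \<Longrightarrow> set_mset (L M) \<subseteq> {..<r}"
    "\<And>M. M \<in> F \<Longrightarrow> fst M = w M + (\<Sum>i\<in>#L M. ms ! i)" by metis
  define T where "T = (\<lambda>M. (w M, snd M)) ` F"
  \<comment> \<open>This makes \<open>g\<close> a polynomial: finitely many degrees occur in
    \<open>f\<close>, there are finitely many odd parts, and each combination fixes the even degree,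
    hence leaves finitely many cofactors.\<close>
  have "finite T"
  proof (rule finite_subset)
    let ?Js = "Pow {..<length (odd_degs U)}"
    show "T \<subseteq> (\<Union>k\<in>mdeg U ` F. \<Union>J\<in>?Js. V (k - (\<Sum>j\<in>J. odd_degs U ! j))) \<times> ?Js"
    proof
      fix K assume "K \<in> T"
      then obtain M where M: "M \<in> F" "K = (w M, snd M)" by (auto simp: T_def)
      then have J: "snd M \<in> ?Js" using F_mon(2) by blast
      have "(\<Sum>a\<in>#fst M. ds ! a) = mdeg U M - (\<Sum>j\<in>snd M. odd_degs U ! j)"
        by (simp add: mdeg_def ds_def case_prod_unfold)
      then have "w M \<in> V (mdeg U M - (\<Sum>j\<in>snd M. odd_degs U ! j))" using wL(1)[OF M(1)] by simp
      then show "K \<in> (\<Union>k\<in>mdeg U ` F. \<Union>J\<in>?Js. V (k - (\<Sum>j\<in>J. odd_degs U ! j))) \<times> ?Js"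
        using M J by blast
    qed
  qed (intro finite_cartesian_product finite_UN_I fin V(1); simp)
  have T_sub: "T \<subseteq> monomials U"
  proof
    fix K assume "K \<in> T"
    then obtain M where M: "M \<in> F" "K = (w M, snd M)" by (auto simp: T_def)
    then have "set_mset (w M) \<subseteq> set_mset (fst M)" using wL(3)[OF M(1)] by simp
    then show "K \<in> monomials U" using M F_mon[OF M(1)] by (auto simp: monomials_def ds_def)
  qed
  obtain W where W: "openin (Euclidean_space (n + r)) W" "S \<subseteq> W"
    and borel: "\<And>c. (\<And>L. smooth_on n S (c L)) \<Longrightarrow> \<exists>G. smooth_on (n + r) W G \<and>
      (\<forall>L. set_mset L \<subseteq> {n..<n + r} \<longrightarrow> (\<forall>x\<in>S. pds (sorted_list_of_multiset L) G x = c L x))"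
    using borel_several_variables[OF S, of r] by blast
  \<comment> \<open>The pair selected for \<open>M\<close>; the shift by \<open>n\<close> is due to
    the y's following the x's.\<close>
  define pt where "pt = (\<lambda>M. ((w M, snd M), image_mset ((+) n) (L M)))"
  define total where "total = (\<lambda>(K :: monomial) L'. (fst K + (\<Sum>i\<in>#L'. ms ! (i - n)), snd K))"
  \<comment> \<open>Pairs that are not selected for their product get 0; otherwise a monomial with
    several factorisations would be counted repeatedly. The factor \<open>multi_fact L'\<close>
    cancels the denominator in the Taylor expansion.\<close>
  define c where "c = (\<lambda>K L'. if total K L' \<in> F \<and> pt (total K L') = (K, L')
    then (\<lambda>x. multi_fact L' * f (total K L') x) else (\<lambda>x. 0))"
  have "smooth_on n S (c K L')" for K L'
    by (auto simp: c_def intro!: smooth_on_const smooth_on_mult S f_smooth)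
  then have "\<forall>K. \<exists>G. smooth_on (n + r) W G \<and>
      (\<forall>L. set_mset L \<subseteq> {n..<n + r} \<longrightarrow> (\<forall>x\<in>S. pds (sorted_list_of_multiset L) G x = c K L x))"
    using borel by blast
  then obtain G where G: "\<And>K. smooth_on (n + r) W (G K)"
    "\<And>K L x. set_mset L \<subseteq> {n..<n + r} \<Longrightarrow> x \<in> S \<Longrightarrow>
      pds (sorted_list_of_multiset L) (G K) x = c K L x" by metis
  define g where "g = (\<lambda>K. if K \<in> T then (\<lambda>p. if p \<in> W then G K p else 0) else (\<lambda>p. 0))"
  define U' where "U' = \<lparr>base_dim = n + r, base = W, even_degs = ds, odd_degs = odd_degs U\<rparr>"
  have U': "graded_chart U'" using U W(1) by (auto simp: graded_chart_def U'_def ds_def)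
  have mon: "monomials U' = monomials U" by (simp add: monomials_def U'_def ds_def)
  have g: "g \<in> polynomial_funs U'"
    using smooth_funs_restrict[OF W(1) G(1)] smooth_funs_zero[OF W(1)] T_sub
    unfolding polynomial_funs_def mon
    by (auto simp: g_def U'_def split: if_splits intro: finite_subset[OF _ \<open>finite T\<close>])
  define \<phi> where "\<phi> = \<lparr>comp_base = (\<lambda>i. if i < n then monomial_series S ({#}, {}) (\<lambda>x. x i)
      else monomial_series S (ms ! (i - n), {}) (\<lambda>_. 1)),
    comp_even = (\<lambda>a. monomial_series S ({#a#}, {}) (\<lambda>_. 1)),
    comp_odd = (\<lambda>j. monomial_series S ({#}, {j}) (\<lambda>_. 1))\<rparr>"
  have msi: "ms ! (i - n) \<noteq> {#}" "(ms ! (i - n), {}) \<in> monomials U" "mdeg U (ms ! (i - n), {}) = 0"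
    if "n \<le> i" "i < n + r" for i
  proof -
    have "ms ! (i - n) \<in> set ms" using that by (auto simp: r_def)
    from ms[OF this] show "ms ! (i - n) \<noteq> {#}" "(ms ! (i - n), {}) \<in> monomials U"
      "mdeg U (ms ! (i - n), {}) = 0" by (auto simp: monomials_def mdeg_def ds_def)
  qed
  note graded = monomial_series_graded[OF U, folded n_def S_def]
  have base_comp: "comp_base \<phi> i \<in> graded_funs_hom U 0 \<and> comp_base \<phi> i \<in> polynomial_funs U"
    if "i < n + r" for i
  proof (cases "i < n")
    case True
    then show ?thesis using graded[OF smooth_on_coordinate[OF S], of "({#}, {})" i]
      by (simp add: \<phi>_def monomials_def mdeg_def)
  next
    case False
    then show ?thesis using graded[OF smooth_on_const[OF S] msi(2), of i 1] msi(3)[of i] that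
      by (simp add: \<phi>_def)
  qed
  have even_comp: "comp_even \<phi> a \<in> graded_funs_hom U (ds ! a) \<and> comp_even \<phi> a \<in> polynomial_funs U"
    if "a < length ds" for a
    using graded[OF smooth_on_const[OF S], of "({#a#}, {})" 1] that
    by (simp add: \<phi>_def monomials_def mdeg_def ds_def)
  have odd_comp: "comp_odd \<phi> j \<in> graded_funs_hom U (odd_degs U ! j) \<and> comp_odd \<phi> j \<in> polynomial_funs U"
    if "j < length (odd_degs U)" for j
    using graded[OF smooth_on_const[OF S], of "({#}, {j})" 1] that
    by (simp add: \<phi>_def monomials_def mdeg_def)
  \<comment> \<open>Generators are not constant, so the y-components have body 0. The body map is
    the zero section, which in this encoding is the identity on \<open>S\<close>.\<close>
  have body: "body_map U' \<phi> x = x" if "x \<in> S" for x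
  proof
    fix i
    show "body_map U' \<phi> x i = x i"
      using that msi(1)[of i] openin_Euclidean_spaceD[OF S that, of i]
      by (auto simp: body_map_def U'_def \<phi>_def monomial_series_def)
  qed
  have "body_map U' \<phi> ` base U \<subseteq> base U'" using body W(2) by (auto simp: S_def U'_def)
  then have \<phi>: "class_morphism polynomial_funs U U' \<phi>"
    using base_comp even_comp odd_comp
    by (simp add: class_morphism_def degree_preserving_def U'_def)
  have pullback: "pullback U U' \<phi> g = f"
  proof (intro ext)
    fix M x
    show "pullback U U' \<phi> g M x = f M x"
    proof (cases "x \<in> S")
      case False
      then show ?thesis using f_smooth(2) by (simp add: pullback_def S_def)
    next
      case x: True
      have x_W: "x \<in> W" using x W(2) by blast
      have taylor: "pds (sorted_list_of_multiset L') (g K) x = (if K \<in> T then c K L' x else 0)"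
        if "set_mset L' \<subseteq> {n..<n + r}" for K L'
      proof (cases "K \<in> T")
        case True
        have "set (sorted_list_of_multiset L') \<subseteq> {..<n + r}" using that by auto
        then have "pds (sorted_list_of_multiset L') (g K) x = pds (sorted_list_of_multiset L') (G K) x"
          using True x_W by (intro pds_cong[OF W(1)]) (auto simp: g_def)
        then show ?thesis using G(2)[OF that x] True by simp
      qed (simp only: g_def if_False pds_zero)
      \<comment> \<open>The pull-back of an original coordinate has no nilpotent part, so Taylor
        terms involving a derivative in x drop out.\<close>
      have nil_zero: "nil_power \<phi> L' M x = 0" if "i \<in># L'" "i < n" for L' i M
        unfolding nil_power_def using that
        by (intro ser_prod_eq_zero[of "nil_part \<phi> i"])
          (auto simp: nil_part_def \<phi>_def monomial_series_def)
      have nil: "monomial_at x (nil_power \<phi> L') (\<Sum>i\<in>#L'. ms ! (i - n), {})"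
        if L': "set_mset L' \<subseteq> {n..<n + r}" for L'
      proof -
        have factor: "monomial_at x (nil_part \<phi> i) (ms ! (i - n), {})" if "i \<in> set (sorted_list_of_multiset L')" for i
          using that L' msi(1)[of i] x
          by (auto simp: monomial_at_def nil_part_def \<phi>_def monomial_series_def)
        have "monomial_at x (ser_prod []) ({#}, {})" by (simp add: ser_prod_def monomial_at_ser_one)
        then have "monomial_at x (ser_prod (map (nil_part \<phi>) (sorted_list_of_multiset L') @ []))
            ((\<Sum>i\<leftarrow>sorted_list_of_multiset L'. ms ! (i - n)) + {#}, {})"
          by (intro monomial_at_ser_prod_even factor) auto
        then show ?thesis by (simp add: nil_power_def sum_list_map_sorted_list_of_multiset)
      qed
      have comp: "monomial_at x (comp_power \<phi> K) K" if "K \<in> monomials U" for K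
      proof -
        obtain I J where K: "K = (I, J)" by force
        have fin: "finite J" using finite_snd_monomials[OF that] K by simp
        have "monomial_at x (ser_prod (map (comp_odd \<phi>) (sorted_list_of_set J))) ({#}, set (sorted_list_of_set J))"
          by (rule monomial_at_ser_prod_odd) (simp_all add: \<phi>_def monomial_at_monomial_series x)
        then have "monomial_at x (comp_power \<phi> K)
            ((\<Sum>a\<leftarrow>sorted_list_of_multiset I. {#a#}) + {#}, set (sorted_list_of_set J))"
          unfolding K comp_power_def split
          by (intro monomial_at_ser_prod_even) (simp_all add: \<phi>_def monomial_at_monomial_series x)
        then show ?thesis using fin by (simp add: K sum_list_map_sorted_list_of_multiset)
      qed
      define t where "t = (\<lambda>(K, L'). 1 / multi_fact L' * pds (sorted_list_of_multiset L') (g K) x *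
         ser_mult (nil_power \<phi> L') (comp_power \<phi> K) M x)"
      have t: "t (K, L') = (if M \<in> F \<and> (K, L') = pt M then f M x else 0)"
        if K: "K \<in> monomials U" and L': "set_mset L' \<subseteq> {..<n + r}" for K L'
      proof (cases "set_mset L' \<subseteq> {n..<n + r}")
        case True
        have "snd K \<subseteq> {..<length (odd_degs U)}" using K by (auto simp: monomials_def)
        then have "finite (snd K)" by (rule finite_subset) simp
        then have "monomial_at x (ser_mult (nil_power \<phi> L') (comp_power \<phi> K))
            ((\<Sum>i\<in>#L'. ms ! (i - n)) + fst K, {} \<union> snd K)"
          using comp[OF K] by (intro monomial_at_ser_mult nil[OF True]) auto
        then have "ser_mult (nil_power \<phi> L') (comp_power \<phi> K) M x = (if M = total K L' then 1 else 0)"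
          by (simp add: monomial_at_def total_def add.commute)
        then have "t (K, L') = (if K \<in> T \<and> M = total K L' then 1 / multi_fact L' * c K L' x else 0)"
          by (simp add: t_def taylor[OF True])
        also have "\<dots> = (if K \<in> T \<and> M = total K L' \<and> M \<in> F \<and> pt M = (K, L') then f M x else 0)"
          by (auto simp: c_def multi_fact_nonzero)
        also have "(K \<in> T \<and> M = total K L' \<and> M \<in> F \<and> pt M = (K, L')) \<longleftrightarrow> M \<in> F \<and> (K, L') = pt M"
        proof -
          have "K \<in> T \<and> M = total K L'" if M: "M \<in> F" "(K, L') = pt M"
          proof
            show "K \<in> T" using M by (auto simp: pt_def T_def)
            have "(\<Sum>i\<in>#L'. ms ! (i - n)) = (\<Sum>i\<in>#L M. ms ! i)"
              using M(2) by (simp add: pt_def image_mset.compositionality o_def)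
            then show "M = total K L'" using wL(3)[OF M(1)] M(2) by (simp add: total_def pt_def prod_eq_iff)
          qed
          then show ?thesis by auto
        qed
        finally show ?thesis .
      next
        case False
        then obtain i where i: "i \<in># L'" "i < n" using L' by force
        have "ser_mult (nil_power \<phi> L') (comp_power \<phi> K) M x = 0"
          by (cases M) (simp add: ser_mult_def nil_zero[OF i])
        moreover have "(K, L') \<noteq> pt M" using i by (auto simp: pt_def)
        ultimately show ?thesis by (simp add: t_def)
      qed
      have "pullback U U' \<phi> g M x = infsum t (monomials U \<times> {L'. set_mset L' \<subseteq> {..<n + r}})"
        using x body[OF x] unfolding pullback_def mon t_def by (simp add: S_def U'_def)
      \<comment> \<open>For \<open>M\<close> outside \<open>F\<close> the value \<open>pt M\<close>
        is unspecified and may leave the index set; both sides are then 0 because \<open>f M\<close>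
        vanishes.\<close>
      also have "\<dots> = infsum (\<lambda>_. f M x) {pt M}"
      proof (rule infsum_cong_neutral)
        fix p assume "p \<in> monomials U \<times> {L'. set_mset L' \<subseteq> {..<n + r}} - {pt M}"
        then show "t p = 0" using t by (cases p) auto
      next
        fix p assume p: "p \<in> monomials U \<times> {L'. set_mset L' \<subseteq> {..<n + r}} \<inter> {pt M}"
        obtain K L' where KL: "p = (K, L')" by (cases p)
        with p have "t p = (if M \<in> F then f M x else 0)" using t[of K L'] by auto
        then show "t p = f M x" by (auto simp: F_def)
      next
        fix p assume p: "p \<in> {pt M} - monomials U \<times> {L'. set_mset L' \<subseteq> {..<n + r}}"
        have "pt M \<in> monomials U \<times> {L'. set_mset L' \<subseteq> {..<n + r}}" if "M \<in> F"
        proof -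
          have "(w M, snd M) \<in> T" using that by (auto simp: T_def)
          then show ?thesis using T_sub wL(2)[OF that] by (auto simp: pt_def)
        qed
        with p have "M \<notin> F" by blast
        then show "f M x = 0" by (simp add: F_def)
      qed
      finally show ?thesis by simp
    qed
  qed
  from U' \<phi> g pullback show thesis by (rule that)
qed

theorem theorem1:
  shows "(contains_polynomials graded_funs \<and> morphism_stable graded_funs) \<and>
    (\<forall>C. function_class C \<and> contains_polynomials C \<and> morphism_stable C \<longrightarrow>
       (\<forall>U. graded_chart U \<longrightarrow> C U = graded_funs U))"
proof (intro conjI allI impI)
  show "contains_polynomials graded_funs"
    using polynomial_funs_subset_graded_funs by (simp add: contains_polynomials_def)
  show "morphism_stable graded_funs" by (rule morphism_stable_graded_funs)
  fix C U
  assume C: "function_class C \<and> contains_polynomials C \<and> morphism_stable C" and U: "graded_chart U"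
  have "f \<in> C U" if f: "f \<in> graded_funs U" for f
  proof -
    obtain U' \<phi> g where *: "graded_chart U'" "class_morphism polynomial_funs U U' \<phi>"
      "g \<in> polynomial_funs U'" "pullback U U' \<phi> g = f"
      using graded_fun_is_pullback[OF U f] by blast
    have P: "polynomial_funs U \<subseteq> C U" "polynomial_funs U' \<subseteq> C U'"
      using C U *(1) by (auto simp: contains_polynomials_def)
    \<comment> \<open>The components are polynomials, so they belong to every competing class and
      \<phi> is a morphism of its type.\<close>
    then have "class_morphism C U U' \<phi>" using *(2) by (auto simp: class_morphism_def)
    then have "pullback U U' \<phi> ` C U' \<subseteq> C U" using C U *(1) by (auto simp: morphism_stable_def)
    then show "f \<in> C U" using *(3,4) P(2) by blast
  qed
  then show "C U = graded_funs U" using C U by (auto simp: function_class_def)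
qed

end
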